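(* Suppose $(\bar A,\bar b)$, $\bar A\in\{0,*\}^{n\times n}$, $\bar b\in\{0,*\}^{n\times1}$, is structurally controllable, and $\bar F\in\{0,*\}^{n\times(n+1)}$ has only one nonzero entry, at position $(i,j)$. Then there exists a $k\in\Omega_j$ with ${\rm minWMM}({\cal G}^{j_{\rm c}}_{ki^*})<|{\cal V}_k^+|$ if and only if there is a path family $\tilde{\cal M}$ of $\tilde{\cal G}(\bar A,\bar b)-\{x_j^{\rm o},x_i^{\rm i}\}$ with size $n-1$ and a $k\in\tilde\Omega_j$ such that $\tilde{\cal M}$ contains at most $|\tilde{\cal V}_k^+|-1$ edges of $\tilde{\cal G}_k$.
   Context: A structured matrix has entries in $\{0,*\}$; its realizations are the complex matrices vanishing wherever it has a $0$ entry; a generic realization has its $*$ entries replaced by independent free parameters. $(A,b)$ is controllable if $[b,Ab,\dots,A^{n-1}b]$ has rank $n$; $(\bar A,\bar b)$ is structurally controllable if it has a controllable realization. ${\cal J}_p=\{1,\dots,p\}$. First construction ($\Omega_j$, ${\cal V}_k^+$, ${\cal G}^{j_{\rm c}}_{ki^*}$). Let $[A,b]$ be a generic realization of $[\bar A,\bar b]$, $H_\lambda=[A-\lambda I,b]$, and let $H_\lambda^{j_{\rm c}}$ be $H_\lambda$ with column $j$ removed. The bipartite graph ${\cal B}(H_\lambda)=({\cal V}^+,{\cal V}^-,{\cal E})$ has ${\cal V}^+=\{x_1,\dots,x_n\}$ (rows), ${\cal V}^-=\{v_1,\dots,v_{n+1}\}$ (columns), ${\cal E}={\cal E}_I\cup{\cal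 E}_{[\bar A,\bar b]}$ with ${\cal E}_I=\{(x_l,v_l):l=1,\dots,n\}$, ${\cal E}_{[\bar A,\bar b]}=\{(x_l,v_k):[\bar A,\bar b]_{lk}\neq0\}$ (no parallel edges). An edge in ${\cal E}_I$ is a $\lambda$-edge; an edge in ${\cal E}_I\cap{\cal E}_{[\bar A,\bar b]}$ is a self-loop (so also a $\lambda$-edge). ${\cal B}(H_\lambda^{j_{\rm c}})={\cal B}(H_\lambda)-\{v_j\}$ (it has a matching of size $n$). Let ${\cal G}^{j_{\rm c}}_k=({\cal V}_k^+,{\cal V}_k^-,{\cal E}_k)$, $k=1,\dots,d$, be the components of the Dulmage–Mendelsohn (DM) decomposition of ${\cal B}(H_\lambda^{j_{\rm c}})$ (both tails are empty): the ${\cal V}_k^+$ (resp. ${\cal V}_k^-$) partition the left (resp. right) vertices, ${\cal E}_k$ is the set of edges between ${\cal V}_k^+$ and ${\cal V}_k^-$; ${\cal G}^{j_{\rm c}}_k$ has a maximum matching of size $|{\cal V}_k^+|=|{\cal V}_k^-|$ and each of its edges lies in some maximum matching of it; there are edges between ${\cal V}_k^+$ and ${\cal V}_l^-$ only if $k\le l$; an edge set is a maximum matching of the whole graph iff it is contained in $\bigcup_k{\cal E}_k$ and its intersection with each ${\cal E}_k$ is a maximum matching of ${\cal G}^{j_{\rm c}}_k$; and the decomposition cannot be refined further with these properties. Let $i^*$ be the index with $x_i\in{\cal V}_{i^*}^+$. For a bipartite graph ${\cal G}$ some of whose edges are designated $\lambda$-edges and self-loops, let $\gamma_{\min}({\cal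 G})$, $\gamma_{\max}({\cal G})$ be the minimum and maximum number of $\lambda$-edges in a maximum matching of ${\cal G}$, and let $\gamma_{\rm nz}({\cal G})=1$ if $\gamma_{\max}({\cal G})-\gamma_{\min}({\cal G})>0$ or ${\cal G}$ contains a self-loop, and $\gamma_{\rm nz}({\cal G})=0$ otherwise. Define $\Omega_j=\{k\in\mathbb N:1\le k\le i^*,\gamma_{\rm nz}({\cal G}_k^{j_{\rm c}})=1\}$. For $k\in\Omega_j$, ${\cal G}^{j_{\rm c}}_{ki^*}$ is the weighted bipartite graph with left vertices $({\cal V}_k^+\cup\cdots\cup{\cal V}_{i^*}^+)\backslash\{x_i\}$, right vertices ${\cal V}_k^-\cup\cdots\cup{\cal V}_{i^*}^-$, all edges of ${\cal E}$ between them, and weight $1$ on edges in ${\cal E}_k$, $0$ on the others. ${\rm minWMM}$ is the minimum weight over all maximum(-cardinality) matchings. Second construction ($\tilde\Omega_j$, $\tilde{\cal G}_k$). $\tilde{\cal G}(\bar A,\bar b)$ is the directed graph with vertices $x_k^{\rm i},x_k^{\rm o}$, $k=1,\dots,n+1$, and edge set $\tilde{\cal E}_{\bar A}\cup\tilde{\cal E}_{\bar b}\cup\tilde{\cal E}_I$ (no parallel edges), where $\tilde{\cal E}_{\bar A}=\{(x_k^{\rm o},x_l^{\rm i}):\bar A_{lk}\neq0\}$, $\tilde{\cal E}_{\bar b}=\{(x_{n+1}^{\rm o},x_k^{\rm i}):\bar b_k\neq0\}$, $\tilde{\cal E}_I=\{(x_k^{\rm o},x_k^{\rm i}):k=1,\dots,n\}$.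 Here a $\lambda$-edge is an edge in $\tilde{\cal E}_I$ and a self-loop is an edge in $\tilde{\cal E}_I\cap\tilde{\cal E}_{\bar A}$. A path family is a collection of vertex-disjoint elementary paths; its size is the number of edges it contains. ${\cal G}-{\cal V}_s$ is ${\cal G}$ with the vertices ${\cal V}_s$ and their incident edges deleted. Let ${\cal M}$ be a path family of $\tilde{\cal G}(\bar A,\bar b)-\{x_{n+1}^{\rm i},x_j^{\rm o}\}$ of size $n$ (one exists), and let $\tilde{\cal G}_{\cal M}$ be obtained from $\tilde{\cal G}(\bar A,\bar b)-\{x_{n+1}^{\rm i},x_j^{\rm o}\}$ by adding the reversed edges $\{(x_l^{\rm i},x_k^{\rm o}):(x_k^{\rm o},x_l^{\rm i})\in{\cal M}\}$. Let $\tilde{\cal V}_k$, $k=1,\dots,d$, be the vertex sets of the strongly connected components of $\tilde{\cal G}_{\cal M}$, $\tilde{\cal G}_k$ the subgraph of $\tilde{\cal G}(\bar A,\bar b)$ induced by $\tilde{\cal V}_k$, regarded as a bipartite graph with parts $\tilde{\cal V}_k^+=\{x_l^{\rm o}:x_l^{\rm o}\in\tilde{\cal V}_k\}$ and $\tilde{\cal V}_k^-=\{x_l^{\rm i}:x_l^{\rm i}\in\tilde{\cal V}_k\}$. Define $\tilde\Omega_j=\{k\in\mathbb N:1\le k\le d,\ \gamma_{\rm nz}(\tilde{\cal G}_k)=1\}$. *)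

theory Defs
  imports
    "Jordan_Normal_Form.DL_Rank"
    "Graph_Theory.Digraph_Component"
    "Graph_Theory.Vertex_Walk"
begin

text \<open>
  Indices are 0-based: states, and hence the rows and the first \<open>n\<close> columns of \<open>[A, b]\<close>, are
  numbered \<open>0, \<dots>, n - 1\<close>, and the input column is number \<open>n\<close>.  Components of a graph
  decomposition are numbered \<open>1, \<dots>, d\<close>.
\<close>

section \<open>Structured systems\<close>

datatype entry = Zero | Star

definition realization_mat :: "entry mat \<Rightarrow> complex mat \<Rightarrow> bool" where
  "realization_mat S A \<longleftrightarrow> A \<in> carrier_mat (dim_row S) (dim_col S) \<and>
     (\<forall>r < dim_row S. \<forall>c < dim_col S. S $$ (r, c) = Zero \<longrightarrow> A $$ (r, c) = 0)"

definition realization_vec :: "entry vec \<Rightarrow> complex vec \<Rightarrow> bool" where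
  "realization_vec s b \<longleftrightarrow> b \<in> carrier_vec (dim_vec s) \<and>
     (\<forall>r < dim_vec s. s $ r = Zero \<longrightarrow> b $ r = 0)"

definition controllability_mat :: "nat \<Rightarrow> complex mat \<Rightarrow> complex vec \<Rightarrow> complex mat" where
  "controllability_mat n A b = mat_of_cols n (map (\<lambda>k. (A ^\<^sub>m k) *\<^sub>v b) [0..<n])"

definition controllable :: "nat \<Rightarrow> complex mat \<Rightarrow> complex vec \<Rightarrow> bool" where
  "controllable n A b \<longleftrightarrow> vec_space.rank n (controllability_mat n A b) = n"

definition structurally_controllable :: "nat \<Rightarrow> entry mat \<Rightarrow> entry vec \<Rightarrow> bool" where
  "structurally_controllable n Abar bbar \<longleftrightarrow>
     (\<exists>A b. realization_mat Abar A \<and> realization_vec bbar b \<and> controllable n A b)"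

definition sys_mat :: "nat \<Rightarrow> entry mat \<Rightarrow> entry vec \<Rightarrow> entry mat" where
  "sys_mat n Abar bbar = mat n (n + 1) (\<lambda>(l, k). if k < n then Abar $$ (l, k) else bbar $ l)"


section \<open>Bipartite graphs and matchings\<close>

text \<open>
  An edge is a pair (left vertex, right vertex).  Left and right vertices may share a type (and
  even names); the position in the pair tells them apart.  All graphs considered are finite.
\<close>

record ('l, 'r) bigraph =
  bleft :: "'l set"
  bright :: "'r set"
  bedges :: "('l \<times> 'r) set"

definition bi_induce :: "('l, 'r) bigraph \<Rightarrow> 'l set \<Rightarrow> 'r set \<Rightarrow> ('l, 'r) bigraph" where
  "bi_induce G L R = \<lparr> bleft = L, bright = R, bedges = bedges G \<inter> (L \<times> R) \<rparr>"

definition matching :: "('l, 'r) bigraph \<Rightarrow> ('l \<times> 'r) set \<Rightarrow> bool" where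
  "matching G M \<longleftrightarrow> M \<subseteq> bedges G \<and> inj_on fst M \<and> inj_on snd M"

definition max_matching :: "('l, 'r) bigraph \<Rightarrow> ('l \<times> 'r) set \<Rightarrow> bool" where
  "max_matching G M \<longleftrightarrow> matching G M \<and> (\<forall>M'. matching G M' \<longrightarrow> card M' \<le> card M)"

definition minWMM :: "('l, 'r) bigraph \<Rightarrow> ('l \<times> 'r \<Rightarrow> nat) \<Rightarrow> nat" where
  "minWMM G w = Min ((\<lambda>M. sum w M) ` {M. max_matching G M})"

text \<open>Below, \<open>L\<close> is the set of \<open>\<lambda>\<close>-edges and \<open>S\<close> the set of self-loops of an ambient graph.\<close>

definition gamma_min :: "('l \<times> 'r) set \<Rightarrow> ('l, 'r) bigraph \<Rightarrow> nat" where
  "gamma_min L G = Min ((\<lambda>M. card (M \<inter> L)) ` {M. max_matching G M})"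

definition gamma_max :: "('l \<times> 'r) set \<Rightarrow> ('l, 'r) bigraph \<Rightarrow> nat" where
  "gamma_max L G = Max ((\<lambda>M. card (M \<inter> L)) ` {M. max_matching G M})"

definition gamma_nz :: "('l \<times> 'r) set \<Rightarrow> ('l \<times> 'r) set \<Rightarrow> ('l, 'r) bigraph \<Rightarrow> nat" where
  "gamma_nz L S G =
     (if gamma_max L G - gamma_min L G > 0 \<or> bedges G \<inter> S \<noteq> {} then 1 else 0)"


section \<open>Dulmage--Mendelsohn decomposition with empty tails\<close>

definition dm_conditions ::
  "('l, 'r) bigraph \<Rightarrow> nat \<Rightarrow> (nat \<Rightarrow> 'l set) \<Rightarrow> (nat \<Rightarrow> 'r set) \<Rightarrow> bool" where
  "dm_conditions G d Vp Vm \<longleftrightarrow>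
     (\<forall>k \<in> {1..d}. Vp k \<noteq> {} \<and> Vm k \<noteq> {}) \<and>
     disjoint_family_on Vp {1..d} \<and> (\<Union>k \<in> {1..d}. Vp k) = bleft G \<and>
     disjoint_family_on Vm {1..d} \<and> (\<Union>k \<in> {1..d}. Vm k) = bright G \<and>
     (\<forall>k \<in> {1..d}. card (Vp k) = card (Vm k) \<and>
        (\<exists>M. max_matching (bi_induce G (Vp k) (Vm k)) M \<and> card M = card (Vp k)) \<and>
        (\<forall>e \<in> bedges (bi_induce G (Vp k) (Vm k)).
           \<exists>M. max_matching (bi_induce G (Vp k) (Vm k)) M \<and> e \<in> M)) \<and>
     (\<forall>k \<in> {1..d}. \<forall>l \<in> {1..d}. bedges G \<inter> (Vp k \<times> Vm l) \<noteq> {} \<longrightarrow> k \<le> l) \<and>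
     (\<forall>M. max_matching G M \<longleftrightarrow>
        M \<subseteq> (\<Union>k \<in> {1..d}. bedges (bi_induce G (Vp k) (Vm k))) \<and>
        (\<forall>k \<in> {1..d}. max_matching (bi_induce G (Vp k) (Vm k))
           (M \<inter> bedges (bi_induce G (Vp k) (Vm k)))))"

text \<open>
  The components are determined by the graph; their numbering is any order compatible with the
  block triangular structure.  A proper refinement has more (nonempty) components.
\<close>

definition dm_decomposition ::
  "('l, 'r) bigraph \<Rightarrow> nat \<Rightarrow> (nat \<Rightarrow> 'l set) \<Rightarrow> (nat \<Rightarrow> 'r set) \<Rightarrow> bool" where
  "dm_decomposition G d Vp Vm \<longleftrightarrow> dm_conditions G d Vp Vm \<and>
     \<not> (\<exists>d' Vp' Vm'. d < d' \<and> dm_conditions G d' Vp' Vm' \<and>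
          (\<forall>k' \<in> {1..d'}. \<exists>k \<in> {1..d}. Vp' k' \<subseteq> Vp k \<and> Vm' k' \<subseteq> Vm k))"


section \<open>The bipartite graph of \<open>[A - \<lambda>I, b]\<close>\<close>

definition lambda_edges :: "nat \<Rightarrow> (nat \<times> nat) set" where
  "lambda_edges n = {(l, l) | l. l < n}"

definition sys_edges :: "nat \<Rightarrow> entry mat \<Rightarrow> entry vec \<Rightarrow> (nat \<times> nat) set" where
  "sys_edges n Abar bbar = {(l, k). l < n \<and> k < n + 1 \<and> sys_mat n Abar bbar $$ (l, k) \<noteq> Zero}"

definition B_H :: "nat \<Rightarrow> entry mat \<Rightarrow> entry vec \<Rightarrow> (nat, nat) bigraph" where
  "B_H n Abar bbar =
     \<lparr> bleft = {..<n}, bright = {..<n + 1}, bedges = lambda_edges n \<union> sys_edges n Abar bbar \<rparr>"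

text \<open>Column \<open>j\<close> removed.\<close>

definition B_H_del :: "nat \<Rightarrow> entry mat \<Rightarrow> entry vec \<Rightarrow> nat \<Rightarrow> (nat, nat) bigraph" where
  "B_H_del n Abar bbar j =
     bi_induce (B_H n Abar bbar) (bleft (B_H n Abar bbar)) (bright (B_H n Abar bbar) - {j})"

definition dm_comp :: "nat \<Rightarrow> entry mat \<Rightarrow> entry vec \<Rightarrow> nat \<Rightarrow>
    (nat \<Rightarrow> nat set) \<Rightarrow> (nat \<Rightarrow> nat set) \<Rightarrow> nat \<Rightarrow> (nat, nat) bigraph" where
  "dm_comp n Abar bbar j Vp Vm k = bi_induce (B_H_del n Abar bbar j) (Vp k) (Vm k)"

definition Omega :: "nat \<Rightarrow> entry mat \<Rightarrow> entry vec \<Rightarrow> nat \<Rightarrow>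
    (nat \<Rightarrow> nat set) \<Rightarrow> (nat \<Rightarrow> nat set) \<Rightarrow> nat \<Rightarrow> nat set" where
  "Omega n Abar bbar j Vp Vm istar =
     {k. 1 \<le> k \<and> k \<le> istar \<and>
         gamma_nz (lambda_edges n) (lambda_edges n \<inter> sys_edges n Abar bbar)
           (dm_comp n Abar bbar j Vp Vm k) = 1}"

definition G_ki :: "nat \<Rightarrow> entry mat \<Rightarrow> entry vec \<Rightarrow> (nat \<Rightarrow> nat set) \<Rightarrow> (nat \<Rightarrow> nat set) \<Rightarrow>
    nat \<Rightarrow> nat \<Rightarrow> nat \<Rightarrow> (nat, nat) bigraph" where
  "G_ki n Abar bbar Vp Vm i istar k =
     bi_induce (B_H n Abar bbar) ((\<Union>l \<in> {k..istar}. Vp l) - {i}) (\<Union>l \<in> {k..istar}. Vm l)"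

definition weight_k :: "nat \<Rightarrow> entry mat \<Rightarrow> entry vec \<Rightarrow> nat \<Rightarrow>
    (nat \<Rightarrow> nat set) \<Rightarrow> (nat \<Rightarrow> nat set) \<Rightarrow> nat \<Rightarrow> nat \<times> nat \<Rightarrow> nat" where
  "weight_k n Abar bbar j Vp Vm k e =
     (if e \<in> bedges (dm_comp n Abar bbar j Vp Vm k) then 1 else 0)"


section \<open>The auxiliary digraph and path families\<close>

text \<open>\<open>Xin k\<close> and \<open>Xout k\<close> stand for $x_k^{\rm i}$ and $x_k^{\rm o}$.\<close>

datatype xvertex = Xin nat | Xout nat

type_synonym xdigraph = "(xvertex, xvertex \<times> xvertex) pre_digraph"

definition tE_A :: "nat \<Rightarrow> entry mat \<Rightarrow> (xvertex \<times> xvertex) set" where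
  "tE_A n Abar = {(Xout k, Xin l) | k l. k < n \<and> l < n \<and> Abar $$ (l, k) \<noteq> Zero}"

definition tE_b :: "nat \<Rightarrow> entry vec \<Rightarrow> (xvertex \<times> xvertex) set" where
  "tE_b n bbar = {(Xout n, Xin k) | k. k < n \<and> bbar $ k \<noteq> Zero}"

definition tE_I :: "nat \<Rightarrow> (xvertex \<times> xvertex) set" where
  "tE_I n = {(Xout k, Xin k) | k. k < n}"

definition tG :: "nat \<Rightarrow> entry mat \<Rightarrow> entry vec \<Rightarrow> xdigraph" where
  "tG n Abar bbar =
     \<lparr> verts = Xin ` {..<n + 1} \<union> Xout ` {..<n + 1},
       arcs = tE_A n Abar \<union> tE_b n bbar \<union> tE_I n, tail = fst, head = snd \<rparr>"

definition del_verts :: "('a, 'b) pre_digraph \<Rightarrow> 'a set \<Rightarrow> ('a, 'b) pre_digraph" where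
  "del_verts G Vs = G \<restriction> (verts G - Vs)"

definition path_family :: "('a, 'b) pre_digraph \<Rightarrow> 'a vwalk set \<Rightarrow> bool" where
  "path_family G P \<longleftrightarrow>
     (\<forall>p \<in> P. vpath p G) \<and> pairwise (\<lambda>p q. disjnt (set p) (set q)) P"

definition family_edges :: "'a vwalk set \<Rightarrow> ('a \<times> 'a) set" where
  "family_edges P = (\<Union>p \<in> P. set (vwalk_arcs p))"

definition family_size :: "'a vwalk set \<Rightarrow> nat" where
  "family_size P = card (family_edges P)"

definition tG_M :: "nat \<Rightarrow> entry mat \<Rightarrow> entry vec \<Rightarrow> nat \<Rightarrow> xvertex vwalk set \<Rightarrow> xdigraph" where
  "tG_M n Abar bbar j M =
     (let G = del_verts (tG n Abar bbar) {Xin n, Xout j}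
      in G \<lparr> arcs := arcs G \<union> (family_edges M)\<inverse> \<rparr>)"

definition tVp :: "xvertex set \<Rightarrow> xvertex set" where
  "tVp V = {v \<in> V. \<exists>l. v = Xout l}"

definition tVm :: "xvertex set \<Rightarrow> xvertex set" where
  "tVm V = {v \<in> V. \<exists>l. v = Xin l}"

text \<open>Every arc of the digraph goes from an \<open>Xout\<close> to an \<open>Xin\<close> vertex.\<close>

definition tG_comp :: "nat \<Rightarrow> entry mat \<Rightarrow> entry vec \<Rightarrow> xvertex set \<Rightarrow> (xvertex, xvertex) bigraph" where
  "tG_comp n Abar bbar V =
     \<lparr> bleft = tVp V, bright = tVm V, bedges = arcs (tG n Abar bbar \<restriction> V) \<rparr>"

definition tOmega :: "nat \<Rightarrow> entry mat \<Rightarrow> entry vec \<Rightarrow> nat \<Rightarrow> (nat \<Rightarrow> xvertex set) \<Rightarrow> nat set" where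
  "tOmega n Abar bbar d Vt =
     {k. 1 \<le> k \<and> k \<le> d \<and>
         gamma_nz (tE_I n) (tE_I n \<inter> tE_A n Abar) (tG_comp n Abar bbar (Vt k)) = 1}"

end

theory Submission
  imports Defs
begin

text \<open>
  Transposing edges, \<open>(r, c) \<mapsto> (Xout c, Xin r)\<close>, identifies the bipartite graph of
  \<open>[A - \<lambda>I, b]\<close> with the auxiliary digraph.  All arcs of the latter go from \<open>Xout\<close> to \<open>Xin\<close>
  vertices, so its path families have the same edge sets as matchings
  (\<open>path_family_edges_iff_matching\<close>); in particular \<open>M\<close> is a perfect matching of the graph without
  column \<open>j\<close>, and a family \<open>Mt\<close> of size \<open>n - 1\<close> is a matching of that graph that misses exactly
  row \<open>i\<close>.

  The two constructions decompose the graph in the same way: the strongly connected components of the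
  digraph with the arcs of \<open>M\<close> reversed are the blocks of the Dulmage--Mendelsohn decomposition
  (\<open>sccs_verts_eq_blocks\<close>).  They cannot be larger, because the decomposition is block triangular.
  They cannot be smaller, because a block that is not strongly connected could be split, contrary to
  the fineness of the decomposition (\<open>block_indecomposable\<close>).  The invariant \<open>gamma_nz\<close> is
  preserved by the transposition (\<open>gamma_nz_arc_of\<close>), so both sides quantify over the same blocks,
  up to the restriction \<open>k \<le> istar\<close> on one side.

  It remains to compare, for one block \<open>k\<close>, a light maximum matching of the blocks
  \<open>k, \<dots>, istar\<close> without row \<open>i\<close> with a matching of the whole graph that misses row \<open>i\<close> and is not
  perfect on block \<open>k\<close> (\<open>light_window_matching_iff\<close>).  A matching of the former kind is completed by
  \<open>M\<close>.  In the other direction, block triangularity and counting force a matching that misses only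
  row \<open>i\<close> to be perfect on every block after the one containing \<open>i\<close>
  (\<open>upper_blocks_matched_within\<close>), which both yields \<open>k \<le> istar\<close> and makes the restriction to the
  blocks \<open>k, \<dots>, istar\<close> a maximum matching there.
\<close>

section \<open>Perfect matchings\<close>

definition perfect_matching :: "('l, 'r) bigraph \<Rightarrow> ('l \<times> 'r) set \<Rightarrow> bool" where
  "perfect_matching G N \<longleftrightarrow> matching G N \<and> fst ` N = bleft G \<and> snd ` N = bright G"

definition balanced_bigraph :: "('l, 'r) bigraph \<Rightarrow> bool" where
  "balanced_bigraph G \<longleftrightarrow> finite (bleft G) \<and> finite (bright G) \<and>
     bedges G \<subseteq> bleft G \<times> bright G \<and> card (bleft G) = card (bright G)"

lemma bi_induce_simps [simp]:
  "bleft (bi_induce G L R) = L" "bright (bi_induce G L R) = R"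
  "bedges (bi_induce G L R) = bedges G \<inter> (L \<times> R)"
  by (simp_all add: bi_induce_def)

lemma matching_fst_unique:
  "matching G N \<Longrightarrow> (r, c) \<in> N \<Longrightarrow> (r, c') \<in> N \<Longrightarrow> c = c'"
  unfolding matching_def inj_on_def by fastforce

lemma matching_snd_unique:
  "matching G N \<Longrightarrow> (r, c) \<in> N \<Longrightarrow> (r', c) \<in> N \<Longrightarrow> r = r'"
  unfolding matching_def inj_on_def by fastforce

lemma matching_card_fst: "matching G N \<Longrightarrow> card (fst ` N) = card N"
  and matching_card_snd: "matching G N \<Longrightarrow> card (snd ` N) = card N"
  by (simp_all add: matching_def card_image)

lemma matching_card_le:
  assumes "matching G N" "finite A" "fst ` bedges G \<subseteq> A"
  shows "card N \<le> card A"
proof -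
  have "fst ` N \<subseteq> A" using assms by (auto simp: matching_def)
  then show ?thesis using matching_card_fst[OF assms(1)] card_mono[OF assms(2)] by metis
qed

lemma max_matching_iff_card:
  assumes "matching G N0" "card N0 = m" "\<And>N. matching G N \<Longrightarrow> card N \<le> m"
  shows "max_matching G N \<longleftrightarrow> matching G N \<and> card N = m"
  using assms unfolding max_matching_def by (metis le_antisym)

lemma perfect_iff_card:
  assumes "balanced_bigraph G"
  shows "perfect_matching G N \<longleftrightarrow> matching G N \<and> card N = card (bleft G)"
proof -
  have "fst ` N = bleft G \<and> snd ` N = bright G"
    if N: "matching G N" "card N = card (bleft G)"
  proof
    have "fst ` N \<subseteq> bleft G" "snd ` N \<subseteq> bright G"
      using N assms by (auto simp: matching_def balanced_bigraph_def)
    then show "fst ` N = bleft G" "snd ` N = bright G"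
      using N assms matching_card_fst[OF N(1)] matching_card_snd[OF N(1)]
      by (simp_all add: balanced_bigraph_def card_subset_eq)
  qed
  then show ?thesis unfolding perfect_matching_def by (metis matching_card_fst)
qed

lemma max_matching_iff_perfect:
  assumes "balanced_bigraph G" "perfect_matching G N0"
  shows "max_matching G N \<longleftrightarrow> perfect_matching G N"
proof -
  have "card N' \<le> card (bleft G)" if "matching G N'" for N'
    using matching_card_le[OF that, of "bleft G"] assms(1) by (force simp: balanced_bigraph_def)
  then show ?thesis
    using max_matching_iff_card[of G N0 "card (bleft G)" N] assms
    by (simp add: perfect_iff_card)
qed

lemma perfect_iff_left:
  assumes "balanced_bigraph G"
  shows "perfect_matching G N \<longleftrightarrow> matching G N \<and> fst ` N = bleft G"
proof
  assume N: "matching G N \<and> fst ` N = bleft G"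
  then have "card N = card (bleft G)" using matching_card_fst[of G N] by simp
  then show "perfect_matching G N" using N perfect_iff_card[OF assms] by blast
qed (simp add: perfect_matching_def)

text \<open>
Once a single matching covers the whole left side, "maximum" means "covers the left side": a
condition that survives restriction to blocks and unions, unlike maximality itself.
\<close>

lemma max_matching_iff_saturating:
  assumes "finite (bleft G)" "fst ` bedges G \<subseteq> bleft G"
    and "matching G N0" "fst ` N0 = bleft G"
  shows "max_matching G N \<longleftrightarrow> matching G N \<and> fst ` N = bleft G"
proof -
  have "max_matching G N \<longleftrightarrow> matching G N \<and> card N = card (bleft G)"
  proof (rule max_matching_iff_card)
    show "card N0 = card (bleft G)" using assms matching_card_fst by metis
  qed (use assms matching_card_le in auto)
  moreover have "card N = card (bleft G) \<longleftrightarrow> fst ` N = bleft G" if N: "matching G N"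
  proof -
    have "fst ` N \<subseteq> bleft G" using N assms(2) by (auto simp: matching_def)
    then show ?thesis using card_subset_eq[OF assms(1)] matching_card_fst[OF N] by metis
  qed
  ultimately show ?thesis by blast
qed

lemma max_matching_exists:
  assumes "finite (bedges G)"
  shows "\<exists>N. max_matching G N"
proof -
  have empty: "matching G {}" by (simp add: matching_def)
  have bound: "\<forall>N. matching G N \<longrightarrow> card N < Suc (card (bedges G))"
    using assms by (simp add: matching_def card_mono less_Suc_eq_le)
  obtain N where "matching G N" "\<forall>N'. matching G N' \<longrightarrow> card N' \<le> card N"
    using ex_has_greatest_nat[OF empty bound] by (elim exE conjE) (rule that)
  then show ?thesis by (intro exI[of _ N]) (simp add: max_matching_def)
qed

lemma minWMM_less_iff:
  assumes "finite (bedges G)"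
  shows "minWMM G w < m \<longleftrightarrow> (\<exists>N. max_matching G N \<and> sum w N < m)"
proof -
  have "{N. max_matching G N} \<subseteq> Pow (bedges G)" by (auto simp: max_matching_def matching_def)
  then have "finite {N. max_matching G N}" using assms finite_subset by blast
  then show ?thesis
    unfolding minWMM_def using max_matching_exists[OF assms] by (subst Min_less_iff) auto
qed

section \<open>Blocks of a decomposition and perfect matchings\<close>

lemma dm_conditionsD:
  assumes "dm_conditions G d Vp Vm"
  shows "\<forall>k \<in> {1..d}. Vp k \<noteq> {} \<and> Vm k \<noteq> {}"
    and "disjoint_family_on Vp {1..d}" and "(\<Union>k \<in> {1..d}. Vp k) = bleft G"
    and "disjoint_family_on Vm {1..d}" and "(\<Union>k \<in> {1..d}. Vm k) = bright G"
    and "\<forall>k \<in> {1..d}. card (Vp k) = card (Vm k) \<and>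
        (\<exists>M. max_matching (bi_induce G (Vp k) (Vm k)) M \<and> card M = card (Vp k)) \<and>
        (\<forall>e \<in> bedges (bi_induce G (Vp k) (Vm k)).
           \<exists>M. max_matching (bi_induce G (Vp k) (Vm k)) M \<and> e \<in> M)"
    and "\<forall>k \<in> {1..d}. \<forall>l \<in> {1..d}. bedges G \<inter> (Vp k \<times> Vm l) \<noteq> {} \<longrightarrow> k \<le> l"
    and "\<forall>M. max_matching G M \<longleftrightarrow>
        M \<subseteq> (\<Union>k \<in> {1..d}. bedges (bi_induce G (Vp k) (Vm k))) \<and>
        (\<forall>k \<in> {1..d}. max_matching (bi_induce G (Vp k) (Vm k))
           (M \<inter> bedges (bi_induce G (Vp k) (Vm k))))"
  using assms unfolding dm_conditions_def by - (elim conjE, assumption)+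

text \<open>
A decomposition with empty tails together with one perfect matching \<open>M\<close>.  On a graph that has a
perfect matching, and on each block, maximum matchings are exactly perfect matchings, so the
locale speaks of perfect matchings throughout.  \<open>M\<close> will be the matching whose arcs are reversed in
the auxiliary digraph.
\<close>

locale dm_blocks =
  fixes G :: "('l, 'r) bigraph" and d :: nat and Vp :: "nat \<Rightarrow> 'l set" and Vm :: "nat \<Rightarrow> 'r set"
    and M :: "('l \<times> 'r) set"
  assumes balanced: "balanced_bigraph G"
    and conds: "dm_conditions G d Vp Vm"
    and perfect: "perfect_matching G M"
begin

abbreviation block :: "nat \<Rightarrow> ('l, 'r) bigraph" where
  "block k \<equiv> bi_induce G (Vp k) (Vm k)"

lemma finite_left: "finite (bleft G)" and finite_right: "finite (bright G)"
  and edges: "bedges G \<subseteq> bleft G \<times> bright G"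
  using balanced by (auto simp: balanced_bigraph_def)

lemma left_eq: "(\<Union>k \<in> {1..d}. Vp k) = bleft G" and right_eq: "(\<Union>k \<in> {1..d}. Vm k) = bright G"
  and disj_left: "disjoint_family_on Vp {1..d}" and disj_right: "disjoint_family_on Vm {1..d}"
  by (fact dm_conditionsD(3,5,2,4)[OF conds])+

lemma left_block: assumes "r \<in> bleft G" obtains k where "k \<in> {1..d}" "r \<in> Vp k"
  using assms unfolding left_eq[symmetric] by blast

lemma right_block: assumes "c \<in> bright G" obtains k where "k \<in> {1..d}" "c \<in> Vm k"
  using assms unfolding right_eq[symmetric] by blast

lemma left_unique: "r \<in> Vp k \<Longrightarrow> r \<in> Vp l \<Longrightarrow> k \<in> {1..d} \<Longrightarrow> l \<in> {1..d} \<Longrightarrow> k = l"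
  using disj_left unfolding disjoint_family_on_def by blast

lemma right_unique: "c \<in> Vm k \<Longrightarrow> c \<in> Vm l \<Longrightarrow> k \<in> {1..d} \<Longrightarrow> l \<in> {1..d} \<Longrightarrow> k = l"
  using disj_right unfolding disjoint_family_on_def by blast

lemma block_nonempty: "k \<in> {1..d} \<Longrightarrow> Vp k \<noteq> {}"
  and block_card: "k \<in> {1..d} \<Longrightarrow> card (Vp k) = card (Vm k)"
  using dm_conditionsD(1,6)[OF conds] by auto

lemma block_finite: "k \<in> {1..d} \<Longrightarrow> finite (Vp k)" "k \<in> {1..d} \<Longrightarrow> finite (Vm k)"
  using finite_left finite_right unfolding left_eq[symmetric] right_eq[symmetric] by auto

lemma edge_le:
  assumes "(r, c) \<in> bedges G" "r \<in> Vp k" "c \<in> Vm l" "k \<in> {1..d}" "l \<in> {1..d}"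
  shows "k \<le> l"
proof -
  have "bedges G \<inter> (Vp k \<times> Vm l) \<noteq> {}" using assms by auto
  then show ?thesis using dm_conditionsD(7)[OF conds] assms(4,5) by blast
qed

lemma block_balanced: "k \<in> {1..d} \<Longrightarrow> balanced_bigraph (block k)"
  using block_finite block_card by (auto simp: balanced_bigraph_def)

lemma block_max_iff:
  assumes "k \<in> {1..d}"
  shows "max_matching (block k) N \<longleftrightarrow> perfect_matching (block k) N"
proof -
  obtain N0 where "max_matching (block k) N0" "card N0 = card (Vp k)"
    using dm_conditionsD(6)[OF conds] assms by blast
  then have "perfect_matching (block k) N0"
    using perfect_iff_card[OF block_balanced[OF assms]] by (simp add: max_matching_def)
  then show ?thesis using max_matching_iff_perfect[OF block_balanced[OF assms]] by blast
qed

lemma block_edge_in_perfect: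
  assumes "k \<in> {1..d}" "e \<in> bedges (block k)"
  obtains N where "perfect_matching (block k) N" "e \<in> N"
proof -
  have "\<exists>N. max_matching (block k) N \<and> e \<in> N"
    using dm_conditionsD(6)[OF conds] assms by blast
  then show ?thesis using that block_max_iff[OF assms(1)] by blast
qed

lemma max_iff_blockwise:
  "max_matching G N \<longleftrightarrow> N \<subseteq> (\<Union>k \<in> {1..d}. bedges (block k)) \<and>
     (\<forall>k \<in> {1..d}. max_matching (block k) (N \<inter> bedges (block k)))"
  by (rule dm_conditionsD(8)[OF conds, rule_format])

text \<open>
A maximum matching consists of edges inside the blocks, so matched vertices lie in the same block.
\<close>

lemma M_block:
  assumes "k \<in> {1..d}" "(r, c) \<in> M"
  shows "r \<in> Vp k \<longleftrightarrow> c \<in> Vm k"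
proof -
  have "max_matching G M"
    using max_matching_iff_perfect[OF balanced perfect] perfect by blast
  then have "(r, c) \<in> (\<Union>k \<in> {1..d}. bedges (block k))"
    using max_iff_blockwise assms by blast
  then obtain l where "l \<in> {1..d}" "r \<in> Vp l" "c \<in> Vm l" by auto
  then show ?thesis using assms left_unique right_unique by metis
qed

lemma M_edges: "M \<subseteq> bedges G" and M_matching: "matching G M"
  and M_left: "fst ` M = bleft G" and M_right: "snd ` M = bright G"
  using perfect by (auto simp: perfect_matching_def matching_def)

section \<open>Block triangularity and matchings that miss one row\<close>

lemma card_blocks:
  assumes "I \<subseteq> {1..d}"
  shows "card (\<Union>l \<in> I. Vp l) = card (\<Union>l \<in> I. Vm l)"
proof -
  have "finite I" using assms finite_subset by blast
  have "card (\<Union>l \<in> I. Vp l) = (\<Sum>l\<in>I. card (Vp l))"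
    using assms disj_left block_finite \<open>finite I\<close>
    by (intro card_UN_disjoint) (auto simp: disjoint_family_on_def subset_iff)
  also have "\<dots> = (\<Sum>l\<in>I. card (Vm l))" using assms block_card by (intro sum.cong) auto
  also have "\<dots> = card (\<Union>l \<in> I. Vm l)"
    using assms disj_right block_finite \<open>finite I\<close>
    by (intro card_UN_disjoint[symmetric]) (auto simp: disjoint_family_on_def subset_iff)
  finally show ?thesis .
qed

text \<open>
Edges go from a row block to the same or a later column block.  Hence the rows of the blocks
\<open>m, \<dots>, d\<close>, if all are covered, use only columns of these blocks, and by counting they use all
of them.
\<close>

lemma upper_columns_used_by_upper_rows:
  assumes N: "matching G N" and m: "1 \<le> m" and cov: "\<And>l. l \<in> {m..d} \<Longrightarrow> Vp l \<subseteq> fst ` N"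
    and c: "l \<in> {m..d}" "c \<in> Vm l"
  obtains r l' where "(r, c) \<in> N" "l' \<in> {m..d}" "r \<in> Vp l'"
proof -
  let ?R = "\<Union>l \<in> {m..d}. Vp l" and ?C = "\<Union>l \<in> {m..d}. Vm l"
  let ?N = "{e \<in> N. fst e \<in> ?R}"
  have sub: "snd ` ?N \<subseteq> ?C"
  proof
    fix c' assume "c' \<in> snd ` ?N"
    then obtain r l where h: "(r, c') \<in> N" "l \<in> {m..d}" "r \<in> Vp l" by auto
    have E: "(r, c') \<in> bedges G" using N h by (auto simp: matching_def)
    then have "c' \<in> bright G" using edges by blast
    then obtain l' where l': "l' \<in> {1..d}" "c' \<in> Vm l'" by (rule right_block)
    have "l \<in> {1..d}" using h m by auto
    then have "l \<le> l'" using edge_le[OF E h(3) l'(2)] l'(1) by blast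
    then have "l' \<in> {m..d}" using h l' by auto
    then show "c' \<in> ?C" using l' by blast
  qed
  have rows: "fst ` ?N = ?R" using cov by (force simp: image_iff)
  have inj: "inj_on fst ?N" "inj_on snd ?N"
    using N by (auto simp: matching_def intro: inj_on_subset)
  have "card (snd ` ?N) = card (fst ` ?N)" using card_image[OF inj(1)] card_image[OF inj(2)] by simp
  also have "\<dots> = card ?R" unfolding rows ..
  also have "\<dots> = card ?C" using m by (intro card_blocks) auto
  finally have "snd ` ?N = ?C"
    using sub m block_finite(2) by (intro card_subset_eq) auto
  then have "c \<in> snd ` ?N" using c by blast
  then show ?thesis using that by auto
qed

text \<open>
Applying the counting argument at every level \<open>l \<ge> m\<close> pins the matching down block by block: the
columns of the blocks after \<open>l\<close> are exhausted by the rows of those blocks, so a row of block \<open>l\<close>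
can only use a column of block \<open>l\<close>.
\<close>

lemma upper_blocks_matched_within:
  assumes N: "matching G N" and m: "1 \<le> m" and cov: "\<And>l. l \<in> {m..d} \<Longrightarrow> Vp l \<subseteq> fst ` N"
    and e: "(r, c) \<in> N" and l: "l \<in> {m..d}"
  shows "r \<in> Vp l \<longleftrightarrow> c \<in> Vm l"
proof -
  have within: "c \<in> Vm l" if r: "r \<in> Vp l" and l: "l \<in> {m..d}" for l
  proof -
    have E: "(r, c) \<in> bedges G" using N e by (auto simp: matching_def)
    then have "c \<in> bright G" using edges by blast
    then obtain l' where l': "l' \<in> {1..d}" "c \<in> Vm l'" by (rule right_block)
    have "l \<le> l'" using edge_le[OF E r l'(2)] l' l m by auto
    moreover have "\<not> l < l'"
    proof
      assume "l < l'"
      have "Vp q \<subseteq> fst ` N" if "q \<in> {l'..d}" for q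
        using cov[of q] that \<open>l < l'\<close> l by auto
      moreover have "l' \<in> {l'..d}" "1 \<le> l'" using l' by auto
      ultimately obtain r' l'' where r': "(r', c) \<in> N" "l'' \<in> {l'..d}" "r' \<in> Vp l''"
        using upper_columns_used_by_upper_rows[OF N, of l' l' c] l'(2) by blast
      then have "r' = r" using matching_snd_unique[OF N] e by blast
      then have "l'' = l" using left_unique[of r l'' l] r' r l l' m by auto
      then show False using r' \<open>l < l'\<close> by auto
    qed
    ultimately show ?thesis using l' by auto
  qed
  show ?thesis
  proof
    assume "c \<in> Vm l"
    then obtain r' l' where r': "(r', c) \<in> N" "l' \<in> {m..d}" "r' \<in> Vp l'"
      using upper_columns_used_by_upper_rows[OF N m cov l] by blast
    then have "r' = r" using matching_snd_unique[OF N] e by blast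
    then have "c \<in> Vm l'" using within r' by auto
    then have "l' = l" using right_unique[of c l' l] \<open>c \<in> Vm l\<close> r' l m by auto
    then show "r \<in> Vp l" using r' \<open>r' = r\<close> by simp
  qed (use within l in blast)
qed

text \<open>
The window \<open>k, \<dots>, istar\<close> without row \<open>i\<close> inherits from \<open>M\<close> a matching that covers all remaining
rows, so its maximum matchings are those covering all remaining rows.
\<close>

lemma window_max_iff:
  fixes i :: 'l
  assumes k: "1 \<le> k" and istar: "istar \<in> {1..d}"
  defines "H \<equiv> bi_induce G ((\<Union>l \<in> {k..istar}. Vp l) - {i}) (\<Union>l \<in> {k..istar}. Vm l)"
  shows "max_matching H N \<longleftrightarrow> matching H N \<and> fst ` N = bleft H"
proof (rule max_matching_iff_saturating)
  let ?N = "{e \<in> M. fst e \<in> bleft H}"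
  show "finite (bleft H)" using k istar block_finite by (auto simp: H_def)
  show "fst ` bedges H \<subseteq> bleft H" by (auto simp: H_def)
  have "(\<Union>l \<in> {k..istar}. Vp l) \<subseteq> bleft G" unfolding left_eq[symmetric] using k istar by force
  then have "bleft H \<subseteq> fst ` M" by (auto simp: M_left H_def)
  then show "fst ` ?N = bleft H" by auto
  have "?N \<subseteq> bedges H"
  proof clarify
    fix r c assume rc: "(r, c) \<in> M" "fst (r, c) \<in> bleft H"
    then obtain l where l: "l \<in> {k..istar}" "r \<in> Vp l" by (auto simp: H_def)
    then have "c \<in> Vm l" using M_block[of l r c] rc k istar by auto
    then show "(r, c) \<in> bedges H" using rc l M_edges by (auto simp: H_def)
  qed
  then show "matching H ?N"
    using M_matching by (auto simp: matching_def intro: inj_on_subset)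
qed

text \<open>
A matching of the window extends to the whole graph by \<open>M\<close> on the other blocks; block \<open>k\<close> lies
in the window, so its edges stay the same.  Conversely, a matching that misses only
row \<open>i\<close> is perfect on every block after \<open>istar\<close>; this forces \<open>k \<le> istar\<close> when it is deficient on
block \<open>k\<close>, and it leaves no later columns for the rows of the window, so the matching restricts to
a maximum matching of the window with the same edges in block \<open>k\<close>.
\<close>

lemma light_window_matching_iff:
  assumes k: "k \<in> {1..d}" and istar: "istar \<in> {1..d}" and i: "i \<in> Vp istar"
  defines "H \<equiv> bi_induce G ((\<Union>l \<in> {k..istar}. Vp l) - {i}) (\<Union>l \<in> {k..istar}. Vm l)"
  shows "k \<le> istar \<and> minWMM H (\<lambda>e. if e \<in> bedges (block k) then 1 else 0) < card (Vp k) \<longleftrightarrow>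
    (\<exists>N. matching G N \<and> fst ` N = bleft G - {i} \<and> card (N \<inter> bedges (block k)) < card (Vp k))"
    (is "?L \<longleftrightarrow> ?R")
proof -
  let ?w = "\<lambda>e. if e \<in> bedges (block k) then 1 else (0::nat)"
  let ?rows = "\<Union>l \<in> {k..istar}. Vp l" and ?cols = "\<Union>l \<in> {k..istar}. Vm l"
  have "finite (bedges G)" using edges finite_left finite_right finite_subset by blast
  then have finH: "finite (bedges H)" by (simp add: H_def)
  have k1: "1 \<le> k" using k by simp
  note maxH = window_max_iff[OF k1 istar, of i, folded H_def]
  have weight: "sum ?w N = card (N \<inter> bedges (block k))" if "finite N" for N
    using that by (simp add: sum.If_cases del: bi_induce_simps)
  have min: "minWMM H ?w < card (Vp k) \<longleftrightarrow>
      (\<exists>N. matching H N \<and> fst ` N = bleft H \<and> card (N \<inter> bedges (block k)) < card (Vp k))"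
  proof -
    have "sum ?w N = card (N \<inter> bedges (block k))" if "matching H N" for N
      using that weight[of N] finite_subset[OF _ finH] by (simp add: matching_def)
    then show ?thesis unfolding minWMM_less_iff[OF finH] maxH by (metis (no_types, lifting))
  qed
  show ?thesis
  proof
    assume ?L
    then obtain N where N: "matching H N" "fst ` N = bleft H"
      "card (N \<inter> bedges (block k)) < card (Vp k)" and ki: "k \<le> istar"
      using min by blast
    let ?T = "{e \<in> M. fst e \<notin> ?rows}"
    \<comment> \<open>\<open>M\<close> matches the rows outside the window to columns outside the window\<close>
    have T_cols: "c \<notin> ?cols" if "(r, c) \<in> M" "r \<notin> ?rows" for r c
      using that M_block[of _ r c] k istar by fastforce
    have N_H: "N \<subseteq> bedges G" "fst ` N \<subseteq> ?rows" "snd ` N \<subseteq> ?cols" "inj_on fst N" "inj_on snd N"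
      using N(1) by (auto simp: matching_def H_def)
    have "matching G (N \<union> ?T)"
      unfolding matching_def
    proof (intro conjI)
      show "N \<union> ?T \<subseteq> bedges G" using N_H M_edges by auto
      have "inj_on fst ?T" "inj_on snd ?T"
        using M_matching by (auto simp: matching_def intro: inj_on_subset)
      moreover have "fst ` N \<inter> fst ` ?T = {}" "snd ` N \<inter> snd ` ?T = {}"
        using N_H T_cols by fastforce+
      ultimately show "inj_on fst (N \<union> ?T)" "inj_on snd (N \<union> ?T)"
        using N_H by (auto simp: inj_on_Un)
    qed
    moreover have "fst ` (N \<union> ?T) = bleft G - {i}"
    proof -
      have "fst ` ?T = fst ` M - ?rows" by auto
      moreover have "?rows \<subseteq> bleft G" unfolding left_eq[symmetric] using k istar by force
      moreover have "i \<in> ?rows" using i ki by auto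
      ultimately show ?thesis using N(2) by (auto simp: image_Un H_def M_left)
    qed
    moreover have "(N \<union> ?T) \<inter> bedges (block k) = N \<inter> bedges (block k)"
      using ki by auto
    ultimately show ?R using N(3) by (intro exI[of _ "N \<union> ?T"]) simp
  next
    assume ?R
    then obtain N where N: "matching G N" "fst ` N = bleft G - {i}"
      "card (N \<inter> bedges (block k)) < card (Vp k)" by blast
    have cov: "Vp l \<subseteq> fst ` N" if "l \<in> {1..d}" "l \<noteq> istar" for l
    proof -
      have "i \<notin> Vp l" using left_unique[OF i] that istar by blast
      then show ?thesis unfolding N(2) left_eq[symmetric] using that(1) by blast
    qed
    \<comment> \<open>every row of a block after \<open>istar\<close> is covered, so these blocks are matched within themselves\<close>
    have upper: "r \<in> Vp l \<longleftrightarrow> c \<in> Vm l" if "(r, c) \<in> N" "l \<in> {1..d}" "istar < l" for r c l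
    proof (rule upper_blocks_matched_within[OF N(1) _ _ that(1), of l])
      show "Vp l' \<subseteq> fst ` N" if "l' \<in> {l..d}" for l'
        using cov[of l'] that \<open>l \<in> {1..d}\<close> \<open>istar < l\<close> by auto
    qed (use that in auto)
    have ki: "k \<le> istar"
    proof (rule ccontr)
      assume "\<not> k \<le> istar"
      then have "N \<inter> bedges (block k) = {e \<in> N. fst e \<in> Vp k}"
        using upper[of _ _ k] k N(1) by (auto simp: matching_def)
      moreover have "fst ` {e \<in> N. fst e \<in> Vp k} = Vp k"
        using cov[OF k] \<open>\<not> k \<le> istar\<close> by force
      moreover have "inj_on fst {e \<in> N. fst e \<in> Vp k}"
        using N(1) by (auto simp: matching_def intro: inj_on_subset)
      then have "card (fst ` {e \<in> N. fst e \<in> Vp k}) = card {e \<in> N. fst e \<in> Vp k}"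
        by (rule card_image)
      ultimately show False using N(3) by simp
    qed
    let ?N = "{e \<in> N. fst e \<in> ?rows}"
    have "?N \<subseteq> bedges H"
    proof
      fix e assume "e \<in> ?N"
      then obtain r c where e: "e = (r, c)" and rc: "(r, c) \<in> N" "r \<in> ?rows" by (cases e) auto
      then obtain l where l: "l \<in> {k..istar}" "r \<in> Vp l" by auto
      have E: "(r, c) \<in> bedges G" using N(1) rc by (auto simp: matching_def)
      then have "c \<in> bright G" using edges by blast
      then obtain l' where l': "l' \<in> {1..d}" "c \<in> Vm l'" by (rule right_block)
      have l1: "l \<in> {1..d}" using l k istar by auto
      have "l \<le> l'" using edge_le[OF E l(2) l'(2) l1 l'(1)] .
      moreover have "l' \<le> istar"
      proof (rule ccontr)
        assume h: "\<not> l' \<le> istar"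
        then have "r \<in> Vp l'" using upper[OF rc(1) l'(1)] l'(2) by auto
        then show False using left_unique[OF l(2)] l1 l' l h by auto
      qed
      moreover have "r \<noteq> i" using N(2) rc(1) by force
      ultimately show "e \<in> bedges H" using E l l' e by (auto simp: H_def)
    qed
    then have "matching H ?N" using N(1) by (auto simp: matching_def intro: inj_on_subset)
    moreover have "fst ` ?N = bleft H"
    proof -
      have "?rows \<subseteq> bleft G" unfolding left_eq[symmetric] using k istar by force
      moreover have "fst ` ?N = fst ` N \<inter> ?rows" by auto
      ultimately show ?thesis unfolding N(2) by (auto simp: H_def)
    qed
    moreover have "?N \<inter> bedges (block k) = N \<inter> bedges (block k)" using ki by auto
    ultimately have "\<exists>N. matching H N \<and> fst ` N = bleft H \<and> card (N \<inter> bedges (block k)) < card (Vp k)"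
      using N(3) by (intro exI[of _ ?N]) simp
    then show ?L using ki min by blast
  qed
qed

end

section \<open>Indecomposability of the blocks\<close>

lemma matching_card_sides:
  assumes "matching G N"
  shows "card (fst ` N) = card (snd ` N)"
  using matching_card_fst[OF assms] matching_card_snd[OF assms] by simp

context dm_blocks
begin

text \<open>
If the edges of block \<open>k\<close> join \<open>X\<close> only to \<open>Y\<close>, and the other rows only to the other columns,
then the two parts can be numbered \<open>k\<close> and \<open>k + 1\<close>, shifting the later blocks by one.  All the
conditions are inherited because a perfect matching of a block splits into perfect matchings of the
two parts.
\<close>

lemma split_block_refines:
  assumes k: "k \<in> {1..d}" and X: "X \<subseteq> Vp k" "X \<noteq> {}" "X \<noteq> Vp k"
    and Y: "Y \<subseteq> Vm k"
    and closed: "\<And>r c. (r, c) \<in> bedges (block k) \<Longrightarrow> r \<in> X \<longleftrightarrow> c \<in> Y"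
  obtains Vp' Vm' where "dm_conditions G (Suc d) Vp' Vm'"
    "\<forall>k' \<in> {1..Suc d}. \<exists>k \<in> {1..d}. Vp' k' \<subseteq> Vp k \<and> Vm' k' \<subseteq> Vm k"
proof -
  \<comment> \<open>the original block that contains new block \<open>l\<close>\<close>
  define old where "old l = (if l \<le> k then l else l - 1)" for l
  define Vp' where "Vp' l = Vp (old l) \<inter> (if l = k then X else if l = Suc k then - X else UNIV)" for l
  define Vm' where "Vm' l = Vm (old l) \<inter> (if l = k then Y else if l = Suc k then - Y else UNIV)" for l
  let ?new = "\<lambda>l. bi_induce G (Vp' l) (Vm' l)"
  have old: "old l \<in> {1..d}" if "l \<in> {1..Suc d}" for l
    using that k by (auto simp: old_def)
  have old_eq: "l = l' \<or> (l = k \<and> l' = Suc k) \<or> (l = Suc k \<and> l' = k)" if "old l = old l'" for l l'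
    using that by (auto simp: old_def split: if_splits)
  have sub: "Vp' l \<subseteq> Vp (old l)" "Vm' l \<subseteq> Vm (old l)" for l
    by (auto simp: Vp'_def Vm'_def)
  have old_k: "old k = k" "old (Suc k) = k" by (auto simp: old_def)
  have same: "r \<in> Vp' l \<longleftrightarrow> c \<in> Vm' l" if "(r, c) \<in> bedges (block (old l))" for r c l
    using that closed[of r c] old_k by (auto simp: Vp'_def Vm'_def)
  have new_block: "\<exists>l \<in> {1..Suc d}. old l = q \<and> r \<in> Vp' l" if "q \<in> {1..d}" "r \<in> Vp q" for q r
  proof -
    consider "q < k" | "q = k" "r \<in> X" | "q = k" "r \<notin> X" | "k < q" by fastforce
    then show ?thesis
    proof cases
      case 1 then show ?thesis using that by (intro bexI[of _ q]) (auto simp: old_def Vp'_def)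
    next
      case 2 then show ?thesis using that by (intro bexI[of _ q]) (auto simp: old_def Vp'_def)
    next
      case 3 then show ?thesis using that by (intro bexI[of _ "Suc q"]) (auto simp: old_def Vp'_def)
    next
      case 4 then show ?thesis using that by (intro bexI[of _ "Suc q"]) (auto simp: old_def Vp'_def)
    qed
  qed
  have new_block_right: "\<exists>l \<in> {1..Suc d}. old l = q \<and> c \<in> Vm' l" if qc: "q \<in> {1..d}" "c \<in> Vm q" for q c
  proof -
    have "c \<in> snd ` M" using qc M_right right_eq by blast
    then obtain r where r: "(r, c) \<in> M" by auto
    then have rc: "(r, c) \<in> bedges (block q)" "r \<in> Vp q" using M_block[of q r c] qc M_edges by auto
    then obtain l where "l \<in> {1..Suc d}" "old l = q" "r \<in> Vp' l" using new_block qc by blast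
    then show ?thesis using same[of r c l] rc by auto
  qed
  \<comment> \<open>indices with the same original block are separated by \<open>X\<close> and \<open>Y\<close>, others by the original partition\<close>
  have disj: "Vp' l \<inter> Vp' l' = {}" "Vm' l \<inter> Vm' l' = {}"
    if "l \<in> {1..Suc d}" "l' \<in> {1..Suc d}" "l \<noteq> l'" for l l'
  proof -
    have "Vp' l \<inter> Vp' l' = {} \<and> Vm' l \<inter> Vm' l' = {}"
    proof (cases "old l = old l'")
      case True
      then show ?thesis using old_eq[OF True] that(3) by (auto simp: Vp'_def Vm'_def)
    next
      case False
      then have "Vp (old l) \<inter> Vp (old l') = {}" "Vm (old l) \<inter> Vm (old l') = {}"
        using left_unique right_unique old that by blast+
      then show ?thesis using sub by blast
    qed
    then show "Vp' l \<inter> Vp' l' = {}" "Vm' l \<inter> Vm' l' = {}" by auto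
  qed
  have part: "perfect_matching (?new l) (N \<inter> bedges (?new l))"
    if N: "perfect_matching (block (old l)) N" for l N
  proof -
    have NE: "N \<subseteq> bedges (block (old l))" and inj: "inj_on fst N" "inj_on snd N"
      and cov: "fst ` N = Vp (old l)" "snd ` N = Vm (old l)"
      using N by (auto simp: perfect_matching_def matching_def)
    have eq1: "N \<inter> bedges (?new l) = {e \<in> N. fst e \<in> Vp' l}"
      using NE same sub by (fastforce simp del: mem_Sigma_iff)
    have eq2: "N \<inter> bedges (?new l) = {e \<in> N. snd e \<in> Vm' l}"
      using NE same sub by (fastforce simp del: mem_Sigma_iff)
    have "fst ` (N \<inter> bedges (?new l)) = fst ` N \<inter> Vp' l" unfolding eq1 by auto
    then have "fst ` (N \<inter> bedges (?new l)) = Vp' l" unfolding cov using sub by blast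
    moreover have "snd ` (N \<inter> bedges (?new l)) = snd ` N \<inter> Vm' l" unfolding eq2 by auto
    then have "snd ` (N \<inter> bedges (?new l)) = Vm' l" unfolding cov using sub by blast
    moreover have "inj_on fst (N \<inter> bedges (?new l))" "inj_on snd (N \<inter> bedges (?new l))"
      using inj inj_on_subset by blast+
    ultimately show ?thesis by (simp add: perfect_matching_def matching_def le_infI2)
  qed
  have perfect_old: "\<exists>N. perfect_matching (block q) N" if "q \<in> {1..d}" for q
    using dm_conditionsD(6)[OF conds] that block_max_iff by blast
  have new_balanced: "balanced_bigraph (?new l)" if l: "l \<in> {1..Suc d}" for l
  proof -
    obtain N where "perfect_matching (?new l) N" using perfect_old[OF old[OF l]] part by blast
    then have "card (Vp' l) = card (Vm' l)"
      using matching_card_sides by (fastforce simp: perfect_matching_def)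
    moreover have "finite (Vp' l)" "finite (Vm' l)"
      using finite_subset[OF sub(1)] finite_subset[OF sub(2)] block_finite[OF old[OF l]] by blast+
    ultimately show ?thesis by (simp add: balanced_bigraph_def)
  qed
  \<comment> \<open>the new blocks have perfect matchings, so the maximum ones are exactly these\<close>
  have new_max: "max_matching (?new l) N \<longleftrightarrow> perfect_matching (?new l) N" if "l \<in> {1..Suc d}" for l N
    using max_matching_iff_perfect[OF new_balanced[OF that]] perfect_old[OF old[OF that]] part by blast
  have "dm_conditions G (Suc d) Vp' Vm'"
    unfolding dm_conditions_def
  proof (intro conjI)
    show "\<forall>l\<in>{1..Suc d}. Vp' l \<noteq> {} \<and> Vm' l \<noteq> {}"
    proof
      fix l assume l: "l \<in> {1..Suc d}"
      have "Vp' l \<noteq> {}"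
        using X block_nonempty[OF old[OF l]] old_k by (auto simp: Vp'_def)
      moreover have "card (Vp' l) = card (Vm' l)" "finite (Vp' l)"
        using new_balanced[OF l] by (auto simp: balanced_bigraph_def)
      ultimately show "Vp' l \<noteq> {} \<and> Vm' l \<noteq> {}" by auto
    qed
    show "disjoint_family_on Vp' {1..Suc d}" "disjoint_family_on Vm' {1..Suc d}"
      using disj by (auto simp: disjoint_family_on_def)
    show "(\<Union>l \<in> {1..Suc d}. Vp' l) = bleft G"
    proof
      show "(\<Union>l \<in> {1..Suc d}. Vp' l) \<subseteq> bleft G" using sub old left_eq by blast
      show "bleft G \<subseteq> (\<Union>l \<in> {1..Suc d}. Vp' l)"
      proof
        fix x assume "x \<in> bleft G"
        then obtain q where "q \<in> {1..d}" "x \<in> Vp q" by (rule left_block)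
        then show "x \<in> (\<Union>l \<in> {1..Suc d}. Vp' l)" using new_block by blast
      qed
    qed
    show "(\<Union>l \<in> {1..Suc d}. Vm' l) = bright G"
    proof
      show "(\<Union>l \<in> {1..Suc d}. Vm' l) \<subseteq> bright G" using sub old right_eq by blast
      show "bright G \<subseteq> (\<Union>l \<in> {1..Suc d}. Vm' l)"
      proof
        fix x assume "x \<in> bright G"
        then obtain q where "q \<in> {1..d}" "x \<in> Vm q" by (rule right_block)
        then show "x \<in> (\<Union>l \<in> {1..Suc d}. Vm' l)" using new_block_right by blast
      qed
    qed
    show "\<forall>l \<in> {1..Suc d}. card (Vp' l) = card (Vm' l) \<and>
        (\<exists>M. max_matching (?new l) M \<and> card M = card (Vp' l)) \<and>
        (\<forall>e \<in> bedges (?new l). \<exists>M. max_matching (?new l) M \<and> e \<in> M)"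
    proof (intro ballI conjI)
      fix l assume l: "l \<in> {1..Suc d}"
      show "card (Vp' l) = card (Vm' l)" using new_balanced[OF l] by (simp add: balanced_bigraph_def)
      obtain N where N: "perfect_matching (?new l) N" using perfect_old[OF old[OF l]] part by blast
      then have "card N = card (Vp' l)" using perfect_iff_card[OF new_balanced[OF l]] by simp
      then show "\<exists>M. max_matching (?new l) M \<and> card M = card (Vp' l)"
        using N new_max[OF l] by blast
      fix e assume e: "e \<in> bedges (?new l)"
      then have "e \<in> bedges (block (old l))" using sub by auto
      then obtain N where "perfect_matching (block (old l)) N" "e \<in> N"
        using block_edge_in_perfect[OF old[OF l]] by blast
      then have "perfect_matching (?new l) (N \<inter> bedges (?new l))" "e \<in> N \<inter> bedges (?new l)"
        using part e by blast+
      then show "\<exists>M. max_matching (?new l) M \<and> e \<in> M" using new_max[OF l] by blast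
    qed
    show "\<forall>l \<in> {1..Suc d}. \<forall>l' \<in> {1..Suc d}. bedges G \<inter> (Vp' l \<times> Vm' l') \<noteq> {} \<longrightarrow> l \<le> l'"
    proof (intro ballI impI)
      fix l l' assume l: "l \<in> {1..Suc d}" "l' \<in> {1..Suc d}"
        and "bedges G \<inter> (Vp' l \<times> Vm' l') \<noteq> {}"
      then obtain r c where rc: "(r, c) \<in> bedges G" "r \<in> Vp' l" "c \<in> Vm' l'" by blast
      then have "old l \<le> old l'" using edge_le[of r c] old l sub by blast
      show "l \<le> l'"
      proof (rule ccontr)
        assume "\<not> l \<le> l'"
        then have eq: "old l = old l'" using \<open>old l \<le> old l'\<close> by (auto simp: old_def split: if_splits)
        have "r \<in> Vp (old l)" "c \<in> Vm (old l)"
          using rc sub(1)[of l] sub(2)[of l'] unfolding eq by blast+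
        then have "(r, c) \<in> bedges (block (old l))" using rc by simp
        then have "c \<in> Vm' l" using same rc by blast
        then show False using disj(2)[OF l] rc \<open>\<not> l \<le> l'\<close> by auto
      qed
    qed
    \<comment> \<open>no edge of an original block runs between its two parts, so none is lost by splitting\<close>
    have edges_eq: "(\<Union>q \<in> {1..d}. bedges (block q)) = (\<Union>l \<in> {1..Suc d}. bedges (?new l))"
    proof
      show "(\<Union>l \<in> {1..Suc d}. bedges (?new l)) \<subseteq> (\<Union>q \<in> {1..d}. bedges (block q))"
      proof
        fix e assume "e \<in> (\<Union>l \<in> {1..Suc d}. bedges (?new l))"
        then obtain l where "l \<in> {1..Suc d}" "e \<in> bedges (?new l)" by blast
        then have "old l \<in> {1..d}" "e \<in> bedges (block (old l))" using sub old by auto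
        then show "e \<in> (\<Union>q \<in> {1..d}. bedges (block q))" by blast
      qed
      show "(\<Union>q \<in> {1..d}. bedges (block q)) \<subseteq> (\<Union>l \<in> {1..Suc d}. bedges (?new l))"
      proof
        fix e assume "e \<in> (\<Union>q \<in> {1..d}. bedges (block q))"
        then obtain q r c where q: "q \<in> {1..d}" "e = (r, c)" "(r, c) \<in> bedges (block q)"
          by (cases e) blast
        then have "r \<in> Vp q" by auto
        then obtain l where l: "l \<in> {1..Suc d}" "old l = q" "r \<in> Vp' l" using new_block q by blast
        then have "e \<in> bedges (?new l)" using same[of r c l] q by auto
        then show "e \<in> (\<Union>l \<in> {1..Suc d}. bedges (?new l))" using l by blast
      qed
    qed
    have "(\<forall>q \<in> {1..d}. perfect_matching (block q) (N \<inter> bedges (block q))) \<longleftrightarrow>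
        (\<forall>l \<in> {1..Suc d}. perfect_matching (?new l) (N \<inter> bedges (?new l)))" (is "?A \<longleftrightarrow> ?B") for N
    proof
      assume A: ?A
      show ?B
      proof
        fix l assume l: "l \<in> {1..Suc d}"
        have "(N \<inter> bedges (block (old l))) \<inter> bedges (?new l) = N \<inter> bedges (?new l)"
          using sub[of l] by auto
        then show "perfect_matching (?new l) (N \<inter> bedges (?new l))"
          using part[of l "N \<inter> bedges (block (old l))"] A old[OF l] by simp
      qed
    next
      assume B: ?B
      show ?A
      proof
        fix q assume q: "q \<in> {1..d}"
        let ?N = "N \<inter> bedges (block q)"
        have new_edge: "\<exists>l \<in> {1..Suc d}. old l = q \<and> (r, c) \<in> N \<inter> bedges (?new l)" if rc: "(r, c) \<in> ?N" for r c
        proof -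
          have "r \<in> Vp q" using rc by auto
          then obtain l where "l \<in> {1..Suc d}" "old l = q" "r \<in> Vp' l" using new_block q by blast
          then show ?thesis using same[of r c l] rc by auto
        qed
        have "inj_on fst ?N"
        proof (rule inj_onI, clarsimp simp del: bi_induce_simps)
          fix r c c' assume "(r, c) \<in> N" "(r, c) \<in> bedges (block q)" "(r, c') \<in> N" "(r, c') \<in> bedges (block q)"
          then obtain l l' where l: "l \<in> {1..Suc d}" "l' \<in> {1..Suc d}"
            "(r, c) \<in> N \<inter> bedges (?new l)" "(r, c') \<in> N \<inter> bedges (?new l')"
            using new_edge by blast
          then have "l = l'" using disj(1)[of l l'] by auto
          then show "c = c'"
            using matching_fst_unique[of "?new l" "N \<inter> bedges (?new l)" r c c'] B l
            by (auto simp: perfect_matching_def)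
        qed
        moreover have "inj_on snd ?N"
        proof (rule inj_onI, clarsimp simp del: bi_induce_simps)
          fix r r' c assume "(r, c) \<in> N" "(r, c) \<in> bedges (block q)" "(r', c) \<in> N" "(r', c) \<in> bedges (block q)"
          then obtain l l' where l: "l \<in> {1..Suc d}" "l' \<in> {1..Suc d}"
            "(r, c) \<in> N \<inter> bedges (?new l)" "(r', c) \<in> N \<inter> bedges (?new l')"
            using new_edge by blast
          then have "l = l'" using disj(2)[of l l'] by auto
          then show "r = r'"
            using matching_snd_unique[of "?new l" "N \<inter> bedges (?new l)" r c r'] B l
            by (auto simp: perfect_matching_def)
        qed
        moreover have "fst ` ?N = Vp q"
        proof
          show "Vp q \<subseteq> fst ` ?N"
          proof
            fix r assume "r \<in> Vp q"
            then obtain l where l: "l \<in> {1..Suc d}" "old l = q" "r \<in> Vp' l" using new_block q by blast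
            then have "r \<in> fst ` (N \<inter> bedges (?new l))" using B by (simp add: perfect_matching_def)
            moreover have "N \<inter> bedges (?new l) \<subseteq> ?N" using sub[of l] l by auto
            ultimately show "r \<in> fst ` ?N" by blast
          qed
        qed auto
        ultimately show "perfect_matching (block q) ?N"
          unfolding perfect_iff_left[OF block_balanced[OF q]] by (simp add: matching_def le_infI2)
      qed
    qed
    then show "\<forall>N. max_matching G N \<longleftrightarrow> N \<subseteq> (\<Union>l \<in> {1..Suc d}. bedges (?new l)) \<and>
        (\<forall>l \<in> {1..Suc d}. max_matching (?new l) (N \<inter> bedges (?new l)))"
      unfolding max_iff_blockwise edges_eq using block_max_iff new_max by simp
  qed
  then show ?thesis using that sub old by blast
qed

text \<open>
If the neighbours in the block of the columns \<open>Y\<close> all lie in an equally large set \<open>X\<close> of rows, then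
the two sets are cut off in both directions: every perfect matching of the block maps \<open>X\<close> onto
\<open>Y\<close>, and every edge lies in a perfect matching, so no edge from \<open>X\<close> leaves \<open>Y\<close> either.  Unless
they are the whole block, splitting along them would refine the decomposition.  This turns the
absence of refinements into strong connectivity.
\<close>

lemma block_indecomposable:
  assumes dm: "dm_decomposition G d Vp Vm"
    and k: "k \<in> {1..d}" and X: "X \<subseteq> Vp k" "X \<noteq> {}" and Y: "Y \<subseteq> Vm k" and card: "card X = card Y"
    and closed: "\<And>r c. (r, c) \<in> bedges (block k) \<Longrightarrow> c \<in> Y \<Longrightarrow> r \<in> X"
  shows "X = Vp k" and "Y = Vm k"
proof -
  have fin: "finite X" "finite Y" using X Y block_finite[OF k] finite_subset by blast+
  have two_sided: "r \<in> X \<longleftrightarrow> c \<in> Y" if rc: "(r, c) \<in> bedges (block k)" for r c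
  proof
    assume "r \<in> X"
    obtain N where N: "perfect_matching (block k) N" "(r, c) \<in> N"
      using block_edge_in_perfect[OF k rc] by blast
    let ?N = "{e \<in> N. snd e \<in> Y}"
    have m: "matching (block k) N" and "snd ` N = Vm k"
      using N by (auto simp: perfect_matching_def)
    then have cols: "snd ` ?N = Y" using Y by auto
    have mN: "matching (block k) ?N" using m by (auto simp: matching_def intro: inj_on_subset)
    have "fst ` ?N \<subseteq> X" using m closed by (fastforce simp: matching_def)
    moreover have "card (fst ` ?N) = card X"
      using matching_card_sides[OF mN] cols card by simp
    ultimately have "fst ` ?N = X" using card_subset_eq fin by blast
    then obtain c' where "(r, c') \<in> N" "c' \<in> Y" using \<open>r \<in> X\<close> by auto
    then show "c \<in> Y" using matching_fst_unique[OF m N(2)] by blast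
  qed (use closed rc in blast)
  show XV: "X = Vp k"
  proof (rule ccontr)
    assume "X \<noteq> Vp k"
    then obtain Vp' Vm' where "dm_conditions G (Suc d) Vp' Vm'"
        "\<forall>k' \<in> {1..Suc d}. \<exists>k \<in> {1..d}. Vp' k' \<subseteq> Vp k \<and> Vm' k' \<subseteq> Vm k"
      using split_block_refines[OF k X _ Y two_sided] by blast
    then show False using dm unfolding dm_decomposition_def by blast
  qed
  show "Y = Vm k" using card_subset_eq[OF block_finite(2)[OF k] Y] card XV block_card[OF k] by simp
qed

end

section \<open>Matchings as path families\<close>

text \<open>
When no vertex is both the tail and the head of an arc, a path cannot have two consecutive arcs.
\<close>

lemma path_in_one_way_bipartite_digraph:
  assumes "vpath p G" "(u, v) \<in> set (vwalk_arcs p)"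
    and "tail G = fst" "head G = snd" "fst ` arcs G \<inter> snd ` arcs G = {}"
  shows "p = [u, v]"
proof -
  have ends: "arcs_ends G = arcs G" using assms(3,4) by (simp add: arcs_ends_def arc_to_ends_def)
  then have sub: "set (vwalk_arcs p) \<subseteq> arcs G" using assms(1) by (simp add: vpath_def vwalk_def)
  have no2: "\<not> ((x, y) \<in> arcs G \<and> (y, z) \<in> arcs G)" for x y z
    using assms(5) by (metis IntI empty_iff fst_conv image_eqI snd_conv)
  show ?thesis
  proof (cases p rule: vwalk_arcs.cases)
    case (3 x y zs)
    show ?thesis
    proof (cases zs)
      case (Cons z zs')
      then show ?thesis using 3 sub no2[of x y z] by simp
    qed (use 3 assms(2) in simp)
  qed (use assms(2) in simp_all)
qed

text \<open>
Every path has at most one arc, so vertex-disjointness of the paths says that their arcs share no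
end point, and every such set of arcs is obtained from paths of two vertices.
\<close>

lemma path_family_edges_iff_matching:
  assumes "tail G = fst" "head G = snd" "arcs G \<subseteq> verts G \<times> verts G"
    and disj: "fst ` arcs G \<inter> snd ` arcs G = {}"
  shows "(\<exists>P. path_family G P \<and> family_edges P = N) \<longleftrightarrow>
    N \<subseteq> arcs G \<and> inj_on fst N \<and> inj_on snd N"
proof
  have ends: "arcs_ends G = arcs G" using assms(1,2) by (simp add: arcs_ends_def arc_to_ends_def)
  note path = path_in_one_way_bipartite_digraph[OF _ _ assms(1,2) disj]
  {
    assume "\<exists>P. path_family G P \<and> family_edges P = N"
    then obtain P where fam: "path_family G P" and edges: "family_edges P = N" by blast
    have P: "vpath p G" if "p \<in> P" for p using fam that by (simp add: path_family_def)
    have apart: "set p \<inter> set q = {}" if "p \<in> P" "q \<in> P" "p \<noteq> q" for p q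
      using fam that unfolding path_family_def by (auto dest: pairwiseD simp: disjnt_def)
    have N: "N = (\<Union>p \<in> P. set (vwalk_arcs p))" using edges by (simp add: family_edges_def)
    have in_P: "[u, v] \<in> P" if uv: "(u, v) \<in> N" for u v
    proof -
      obtain p where "p \<in> P" "(u, v) \<in> set (vwalk_arcs p)" using uv N by blast
      then show ?thesis using path[OF P] by blast
    qed
    have "N \<subseteq> arcs G" using P ends unfolding N vpath_def vwalk_def by blast
    moreover have "inj_on fst N"
    proof (rule inj_onI, clarsimp)
      fix u v v' assume "(u, v) \<in> N" "(u, v') \<in> N"
      then show "v = v'" using apart[OF in_P in_P, of u v u v'] by auto
    qed
    moreover have "inj_on snd N"
    proof (rule inj_onI, clarsimp)
      fix u u' v assume "(u, v) \<in> N" "(u', v) \<in> N"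
      then show "u = u'" using apart[OF in_P in_P, of u v u' v] by auto
    qed
    ultimately show "N \<subseteq> arcs G \<and> inj_on fst N \<and> inj_on snd N" by blast
  }
  assume N: "N \<subseteq> arcs G \<and> inj_on fst N \<and> inj_on snd N"
  let ?P = "(\<lambda>(u, v). [u, v]) ` N"
  have cross: "v \<noteq> u'" if "(u, v) \<in> N" "(u', v') \<in> N" for u v u' v'
  proof -
    have "v \<in> snd ` arcs G" "u' \<in> fst ` arcs G" using that N by force+
    then show ?thesis using disj by blast
  qed
  have "path_family G ?P"
    unfolding path_family_def pairwise_def
  proof (intro conjI ballI impI)
    fix p assume "p \<in> ?P"
    then obtain u v where p: "p = [u, v]" "(u, v) \<in> N" by auto
    then have "u \<noteq> v" using cross by blast
    then show "vpath p G" using p N assms(3) ends by (auto simp: vpath_def vwalk_def)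
  next
    fix p q assume "p \<in> ?P" "q \<in> ?P" "p \<noteq> q"
    then obtain u v u' v' where pq: "p = [u, v]" "q = [u', v']" "(u, v) \<in> N" "(u', v') \<in> N" by auto
    have ne: "(u, v) \<noteq> (u', v')" using pq(1,2) \<open>p \<noteq> q\<close> by blast
    have inj: "inj_on fst N" "inj_on snd N" using N by blast+
    have "u \<noteq> u'" using inj_onD[OF inj(1) _ pq(3,4)] ne by auto
    moreover have "v \<noteq> v'" using inj_onD[OF inj(2) _ pq(3,4)] ne by auto
    moreover have "v \<noteq> u'" "v' \<noteq> u" using cross[OF pq(3,4)] cross[OF pq(4,3)] by blast+
    ultimately show "disjnt (set p) (set q)" unfolding pq(1,2) by (auto simp: disjnt_def)
  qed
  moreover have "family_edges ?P = N" by (force simp: family_edges_def)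
  ultimately show "\<exists>P. path_family G P \<and> family_edges P = N" by blast
qed

section \<open>Transposing the bipartite graph into the digraph\<close>

text \<open>
An edge joins a row to a column, whereas an arc leaves the vertex of its column and enters the
vertex of its row.  The two descriptions of the system differ by this transposition only.
\<close>

definition arc_of :: "nat \<times> nat \<Rightarrow> xvertex \<times> xvertex" where
  "arc_of e = (Xout (snd e), Xin (fst e))"

lemma arc_of_Pair [simp]: "arc_of (r, c) = (Xout c, Xin r)"
  by (simp add: arc_of_def)

lemma inj_arc_of: "inj_on arc_of A"
  by (auto simp: inj_on_def arc_of_def)

lemma arc_of_image_Int: "arc_of ` A \<inter> arc_of ` B = arc_of ` (A \<inter> B)"
  using image_Int[OF inj_arc_of, of A B] by simp

lemma inj_on_fst_arc_of: "inj_on fst (arc_of ` N) \<longleftrightarrow> inj_on snd N"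
  and inj_on_snd_arc_of: "inj_on snd (arc_of ` N) \<longleftrightarrow> inj_on fst N"
  by (force simp: inj_on_def arc_of_def)+

lemma subset_arc_of_image: "N' \<subseteq> arc_of ` E \<longleftrightarrow> (\<exists>N \<subseteq> E. N' = arc_of ` N)"
  by (metis image_mono subset_imageE)

lemma matching_arc_of_iff:
  assumes "bedges G' = arc_of ` bedges G"
  shows "matching G' N' \<longleftrightarrow> (\<exists>N. N' = arc_of ` N \<and> matching G N)"
  unfolding matching_def assms subset_arc_of_image
  by (auto simp: inj_on_fst_arc_of inj_on_snd_arc_of)

lemma max_matchings_arc_of:
  assumes "bedges G' = arc_of ` bedges G"
  shows "{N'. max_matching G' N'} = image arc_of ` {N. max_matching G N}"
proof -
  have card: "card (arc_of ` N) = card N" for N by (rule card_image[OF inj_arc_of])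
  have bound: "(\<forall>N'. matching G' N' \<longrightarrow> card N' \<le> m) \<longleftrightarrow> (\<forall>N. matching G N \<longrightarrow> card N \<le> m)" for m
    unfolding matching_arc_of_iff[OF assms] using card by auto
  have "max_matching G' N' \<longleftrightarrow> (\<exists>N. N' = arc_of ` N \<and> max_matching G N)" for N'
    unfolding max_matching_def bound unfolding matching_arc_of_iff[OF assms] using card by auto
  then show ?thesis by blast
qed

text \<open>
A matching meets the designated edges only inside the graph, so it suffices that the designated sets
correspond there.
\<close>

lemma gamma_nz_arc_of:
  assumes E: "bedges G' = arc_of ` bedges G"
    and L: "L' \<inter> bedges G' = arc_of ` (L \<inter> bedges G)"
    and S: "S' \<inter> bedges G' = arc_of ` (S \<inter> bedges G)"
  shows "gamma_nz L' S' G' = gamma_nz L S G"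
proof -
  have count: "card (arc_of ` N \<inter> L') = card (N \<inter> L)" if "max_matching G N" for N
  proof -
    have N: "N \<subseteq> bedges G" using that by (simp add: max_matching_def matching_def)
    then have "arc_of ` N \<inter> L' = arc_of ` N \<inter> (L' \<inter> bedges G')" unfolding E by auto
    also have "\<dots> = arc_of ` (N \<inter> L)" unfolding L arc_of_image_Int using N by (auto intro: arg_cong)
    finally show ?thesis by (simp add: card_image[OF inj_arc_of])
  qed
  have "(\<lambda>N. card (N \<inter> L')) ` {N'. max_matching G' N'} = (\<lambda>N. card (N \<inter> L)) ` {N. max_matching G N}"
    unfolding max_matchings_arc_of[OF E] image_image using count by (intro image_cong) auto
  moreover have "bedges G' \<inter> S' = {} \<longleftrightarrow> bedges G \<inter> S = {}" using S by auto
  ultimately show ?thesis unfolding gamma_nz_def gamma_max_def gamma_min_def by simp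
qed

section \<open>Blocks as strongly connected components\<close>

definition block_verts :: "nat set \<Rightarrow> nat set \<Rightarrow> xvertex set" where
  "block_verts R C = Xin ` R \<union> Xout ` C"

lemma in_block_verts [simp]:
  "Xin r \<in> block_verts R C \<longleftrightarrow> r \<in> R" "Xout c \<in> block_verts R C \<longleftrightarrow> c \<in> C"
  by (auto simp: block_verts_def)

text \<open>
Arcs lead from a column to rows of the same or an earlier block and reversed arcs stay within their
block, so mutually reachable vertices share a block.  Conversely, the part of a block reachable from
one of its vertices is closed under passing to the matched partner, hence contains as many rows as
columns, and is closed under neighbours of columns; by indecomposability it is the whole block.
\<close>

lemma sccs_verts_eq_blocks:
  fixes G :: "(nat, nat) bigraph" and D :: xdigraph
  assumes blocks: "dm_blocks G d Vp Vm M" and dm: "dm_decomposition G d Vp Vm"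
    and wf: "wf_digraph D" and V: "verts D = block_verts (bleft G) (bright G)"
    and A: "arcs_ends D = arc_of ` bedges G \<union> (arc_of ` M)\<inverse>"
  shows "pre_digraph.sccs_verts D = (\<lambda>k. block_verts (Vp k) (Vm k)) ` {1..d}"
proof -
  interpret dm_blocks G d Vp Vm M by (rule blocks)
  interpret D: wf_digraph D by (rule wf)
  let ?W = "\<lambda>k. block_verts (Vp k) (Vm k)"
  have edge_step: "(Xout c, Xin r) \<in> arcs_ends D" if "(r, c) \<in> bedges G" for r c
    using that unfolding A by (metis UnI1 arc_of_Pair imageI)
  have M_step: "(Xin r, Xout c) \<in> arcs_ends D" if "(r, c) \<in> M" for r c
    using that unfolding A by (metis UnI2 arc_of_Pair converseI imageI)
  have cover: "\<exists>k \<in> {1..d}. v \<in> ?W k" if "v \<in> verts D" for v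
    using that unfolding V left_eq[symmetric] right_eq[symmetric] by (auto simp: block_verts_def)
  have inV: "?W k \<subseteq> verts D" if "k \<in> {1..d}" for k
  proof -
    have "Vp k \<subseteq> bleft G" "Vm k \<subseteq> bright G"
      unfolding left_eq[symmetric] right_eq[symmetric] using that by blast+
    then show ?thesis unfolding V block_verts_def by blast
  qed
  have W_unique: "k = l" if "v \<in> ?W k" "v \<in> ?W l" "k \<in> {1..d}" "l \<in> {1..d}" for v k l
    using that left_unique right_unique by (cases v) auto
  have down: "\<exists>b \<in> {1..d}. v \<in> ?W b \<and> b \<le> a" if "u \<rightarrow>\<^sup>*\<^bsub>D\<^esub> v" "u \<in> ?W a" "a \<in> {1..d}" for u v a
    using that(1)
  proof (induct rule: D.reachable_induct)
    case base then show ?case using that by blast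
  next
    case (step x y)
    then obtain b where b: "b \<in> {1..d}" "x \<in> ?W b" "b \<le> a" by blast
    have "(x, y) \<in> arc_of ` bedges G \<union> (arc_of ` M)\<inverse>" using step A by simp
    then consider r c where "x = Xout c" "y = Xin r" "(r, c) \<in> bedges G"
      | r c where "x = Xin r" "y = Xout c" "(r, c) \<in> M" by auto
    then show ?case
    proof cases
      case (1 r c)
      then have "r \<in> bleft G" using edges by blast
      then obtain b' where b': "b' \<in> {1..d}" "r \<in> Vp b'" by (rule left_block)
      then have "b' \<le> b" using edge_le[OF 1(3) b'(2)] b 1 by auto
      then show ?thesis using b b' 1 by auto
    next
      case (2 r c)
      then show ?thesis using M_block[OF b(1) 2(3)] b by auto
    qed
  qed
  have connected: "u \<rightarrow>\<^sup>*\<^bsub>D\<^esub> v" if k: "k \<in> {1..d}" and u: "u \<in> ?W k" and v: "v \<in> ?W k" for u v k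
  proof -
    define X where "X = {r \<in> Vp k. u \<rightarrow>\<^sup>*\<^bsub>D\<^esub> Xin r}"
    define Y where "Y = {c \<in> Vm k. u \<rightarrow>\<^sup>*\<^bsub>D\<^esub> Xout c}"
    have closed: "r \<in> X" if "(r, c) \<in> bedges (block k)" "c \<in> Y" for r c
    proof -
      have "(Xout c, Xin r) \<in> arcs_ends D" using that edge_step by auto
      then show ?thesis using that D.reachable_adj_trans unfolding X_def Y_def by auto
    qed
    have M_XY: "r \<in> X \<longleftrightarrow> c \<in> Y" if rc: "(r, c) \<in> M" for r c
    proof
      assume "r \<in> X"
      then show "c \<in> Y"
        using D.reachable_adj_trans[OF _ M_step[OF rc]] M_block[OF k rc] unfolding X_def Y_def by auto
    next
      assume "c \<in> Y"
      then have "(r, c) \<in> bedges (block k)" using M_block[OF k rc] rc M_edges by (auto simp: Y_def)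
      then show "r \<in> X" using closed \<open>c \<in> Y\<close> by blast
    qed
    let ?M = "{e \<in> M. fst e \<in> X}"
    have "X \<subseteq> bleft G" "Y \<subseteq> bright G"
      unfolding left_eq[symmetric] right_eq[symmetric] using k by (auto simp: X_def Y_def)
    have "fst ` ?M = X" using \<open>X \<subseteq> bleft G\<close> unfolding M_left[symmetric] by auto
    moreover have "?M = {e \<in> M. snd e \<in> Y}" using M_XY by auto
    then have "snd ` ?M = Y" using \<open>Y \<subseteq> bright G\<close> unfolding M_right[symmetric] by auto
    moreover have "matching G ?M" using M_matching by (auto simp: matching_def intro: inj_on_subset)
    ultimately have card: "card X = card Y" using matching_card_sides by metis
    have sub: "X \<subseteq> Vp k" "Y \<subseteq> Vm k" by (auto simp: X_def Y_def)
    have "u \<in> verts D" using inV[OF k] u by blast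
    then have "u \<rightarrow>\<^sup>*\<^bsub>D\<^esub> u" by simp
    then have "X \<noteq> {} \<or> Y \<noteq> {}" using u by (cases u) (auto simp: X_def Y_def)
    moreover have "finite X" "finite Y" using block_finite[OF k] sub finite_subset by blast+
    ultimately have ne: "X \<noteq> {}" using card by auto
    note whole = block_indecomposable[OF dm k sub(1) ne sub(2) card]
    have "X = Vp k" by (rule whole(1)) (rule closed)
    moreover have "Y = Vm k" by (rule whole(2)) (rule closed)
    ultimately show ?thesis using v by (cases v) (auto simp: X_def Y_def)
  qed
  have scc: "?W k \<in> D.sccs_verts" if k: "k \<in> {1..d}" for k
    unfolding D.in_sccs_verts_conv_reachable
  proof (intro conjI ballI allI impI)
    show "?W k \<noteq> {}" using block_nonempty[OF k] by (auto simp: block_verts_def)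
  next
    fix u v assume u: "u \<in> ?W k" and v: "v \<notin> ?W k"
    show "\<not> u \<rightarrow>\<^sup>*\<^bsub>D\<^esub> v \<or> \<not> v \<rightarrow>\<^sup>*\<^bsub>D\<^esub> u"
    proof (rule ccontr)
      assume "\<not> ?thesis"
      then have r: "u \<rightarrow>\<^sup>*\<^bsub>D\<^esub> v" "v \<rightarrow>\<^sup>*\<^bsub>D\<^esub> u" by auto
      obtain b where b: "b \<in> {1..d}" "v \<in> ?W b" "b \<le> k" using down[OF r(1) u k] by blast
      obtain a where "a \<in> {1..d}" "u \<in> ?W a" "a \<le> b" using down[OF r(2) b(2,1)] by blast
      then have "b = k" using W_unique[OF u, of a] k b by auto
      then show False using b v by simp
    qed
  qed (use connected[OF k] in blast)
  show ?thesis
  proof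
    show "?W ` {1..d} \<subseteq> D.sccs_verts" using scc by blast
    show "D.sccs_verts \<subseteq> ?W ` {1..d}"
    proof
      fix S assume S: "S \<in> D.sccs_verts"
      then obtain u where u: "u \<in> S" "u \<rightarrow>\<^sup>*\<^bsub>D\<^esub> u" unfolding D.in_sccs_verts_conv_reachable by blast
      then have "u \<in> verts D" using D.reachable_in_verts by blast
      then obtain k where "k \<in> {1..d}" "u \<in> ?W k" using cover by blast
      then show "S \<in> ?W ` {1..d}" using D.sccs_verts_disjoint[OF S scc] u by blast
    qed
  qed
qed

section \<open>The graphs of a structured system\<close>

lemma bedges_B_H:
  "(r, c) \<in> bedges (B_H n Abar bbar) \<longleftrightarrow>
     r < n \<and> (c = r \<or> c < n \<and> Abar $$ (r, c) \<noteq> Zero \<or> c = n \<and> bbar $ r \<noteq> Zero)"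
  by (auto simp: B_H_def lambda_edges_def sys_edges_def sys_mat_def less_Suc_eq)

lemma B_H_del_simps:
  "bleft (B_H_del n Abar bbar j) = {..<n}"
  "bright (B_H_del n Abar bbar j) = {..<n + 1} - {j}"
  "bedges (B_H_del n Abar bbar j) = {e \<in> bedges (B_H n Abar bbar). snd e \<noteq> j}"
  by (auto simp: B_H_del_def bedges_B_H) (auto simp: B_H_def bedges_B_H)

lemma arcs_tG: "arcs (tG n Abar bbar) = arc_of ` bedges (B_H n Abar bbar)"
proof (rule Set.set_eqI)
  fix e
  have "e \<in> arcs (tG n Abar bbar) \<longleftrightarrow>
      (\<exists>r c. e = (Xout c, Xin r) \<and> (r, c) \<in> bedges (B_H n Abar bbar))"
    unfolding bedges_B_H by (auto simp: tG_def tE_A_def tE_b_def tE_I_def)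
  also have "\<dots> \<longleftrightarrow> e \<in> arc_of ` bedges (B_H n Abar bbar)"
    by (auto simp: arc_of_def image_iff) (metis fst_conv snd_conv)
  finally show "e \<in> arcs (tG n Abar bbar) \<longleftrightarrow> e \<in> arc_of ` bedges (B_H n Abar bbar)" .
qed

lemma del_verts_tG_simps:
  "tail (del_verts (tG n Abar bbar) V) = fst"
  "head (del_verts (tG n Abar bbar) V) = snd"
  "verts (del_verts (tG n Abar bbar) V) = Xin ` {..<n + 1} \<union> Xout ` {..<n + 1} - V"
  by (simp_all add: del_verts_def tG_def induce_subgraph_def)

lemma filter_arc_of_image: "{e \<in> arc_of ` E. P e} = arc_of ` {e \<in> E. P (arc_of e)}"
  by blast

lemma arcs_del_verts_tG:
  "arcs (del_verts (tG n Abar bbar) V) =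
     arc_of ` {e \<in> bedges (B_H n Abar bbar). Xin (fst e) \<notin> V \<and> Xout (snd e) \<notin> V}"
proof -
  have "arcs (del_verts (tG n Abar bbar) V) = {e \<in> arcs (tG n Abar bbar). fst e \<notin> V \<and> snd e \<notin> V}"
  proof -
    have "fst e \<in> verts (tG n Abar bbar)" "snd e \<in> verts (tG n Abar bbar)"
      if "e \<in> arcs (tG n Abar bbar)" for e
      using that by (auto simp: arcs_tG arc_of_def bedges_B_H) (auto simp: tG_def)
    then show ?thesis by (auto simp: del_verts_def induce_subgraph_def) (auto simp: tG_def)
  qed
  then show ?thesis unfolding arcs_tG filter_arc_of_image
    by (simp add: arc_of_def conj_commute)
qed

lemma path_families_iff_matchings:
  assumes "D = del_verts (tG n Abar bbar) V" and E: "arcs D = arc_of ` E"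
  shows "(\<exists>P. path_family D P \<and> family_edges P = N') \<longleftrightarrow>
    (\<exists>N \<subseteq> E. N' = arc_of ` N \<and> inj_on fst N \<and> inj_on snd N)"
proof -
  have "arcs D \<subseteq> verts D \<times> verts D"
    unfolding assms(1) del_verts_tG_simps arcs_del_verts_tG by (auto simp: bedges_B_H)
  moreover have "fst ` arcs D \<inter> snd ` arcs D = {}" unfolding E by (auto simp: arc_of_def)
  ultimately have "(\<exists>P. path_family D P \<and> family_edges P = N') \<longleftrightarrow>
      N' \<subseteq> arcs D \<and> inj_on fst N' \<and> inj_on snd N'"
    by (intro path_family_edges_iff_matching) (simp_all add: assms(1) del_verts_tG_simps)
  then show ?thesis
    unfolding E subset_arc_of_image by (auto simp: inj_on_fst_arc_of inj_on_snd_arc_of)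
qed

lemma tE_I_arc_of: "tE_I n = arc_of ` lambda_edges n"
  by (auto simp: tE_I_def lambda_edges_def arc_of_def image_iff)

lemma self_loops_arc_of:
  "tE_I n \<inter> tE_A n Abar = arc_of ` (lambda_edges n \<inter> sys_edges n Abar bbar)"
proof -
  have "arc_of (l, l) = (Xout l, Xin l)" for l by simp
  moreover have "lambda_edges n \<inter> sys_edges n Abar bbar = {(l, l) |l. l < n \<and> Abar $$ (l, l) \<noteq> Zero}"
    by (auto simp: lambda_edges_def sys_edges_def sys_mat_def)
  moreover have "tE_I n \<inter> tE_A n Abar = {(Xout l, Xin l) |l. l < n \<and> Abar $$ (l, l) \<noteq> Zero}"
    by (auto simp: tE_I_def tE_A_def)
  ultimately show ?thesis by (auto simp: image_iff arc_of_def)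
qed

lemma bedges_tG_comp:
  "bedges (tG_comp n Abar bbar (block_verts R C)) = arc_of ` (bedges (B_H n Abar bbar) \<inter> (R \<times> C))"
proof -
  have "tail (tG n Abar bbar) = fst" "head (tG n Abar bbar) = snd" by (simp_all add: tG_def)
  then have "bedges (tG_comp n Abar bbar (block_verts R C)) =
      {e \<in> arcs (tG n Abar bbar). fst e \<in> block_verts R C \<and> snd e \<in> block_verts R C}"
    by (simp add: tG_comp_def)
  also have "\<dots> = arc_of ` {e \<in> bedges (B_H n Abar bbar). e \<in> R \<times> C}"
    unfolding arcs_tG filter_arc_of_image
    by (simp add: arc_of_def mem_Times_iff conj_commute)
  finally show ?thesis by (simp only: Int_def)
qed

lemma tVp_block_verts: "tVp (block_verts R C) = Xout ` C"
  by (auto simp: tVp_def block_verts_def)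

theorem proposition8:
  fixes n d d' i j istar :: nat
    and Abar Fbar :: "entry mat" and bbar :: "entry vec"
    and Vp Vm :: "nat \<Rightarrow> nat set"
    and M :: "xvertex vwalk set" and Vt :: "nat \<Rightarrow> xvertex set"
  assumes "Abar \<in> carrier_mat n n" and "bbar \<in> carrier_vec n"
    and "structurally_controllable n Abar bbar"
    and "Fbar \<in> carrier_mat n (n + 1)" and "i < n" and "j < n + 1"
    and "\<forall>r < n. \<forall>c < n + 1. Fbar $$ (r, c) \<noteq> Zero \<longleftrightarrow> r = i \<and> c = j"
    and "dm_decomposition (B_H_del n Abar bbar j) d Vp Vm"
    and "istar \<in> {1..d}" and "i \<in> Vp istar"
    and "path_family (del_verts (tG n Abar bbar) {Xin n, Xout j}) M" and "family_size M = n"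
    and "bij_betw Vt {1..d'} (pre_digraph.sccs_verts (tG_M n Abar bbar j M))"
  shows "(\<exists>k \<in> Omega n Abar bbar j Vp Vm istar.
            minWMM (G_ki n Abar bbar Vp Vm i istar k) (weight_k n Abar bbar j Vp Vm k)
              < card (Vp k))
     \<longleftrightarrow> (\<exists>Mt. path_family (del_verts (tG n Abar bbar) {Xout j, Xin i}) Mt \<and>
            family_size Mt = n - 1 \<and>
            (\<exists>k \<in> tOmega n Abar bbar d' Vt.
               int (card (family_edges Mt \<inter> bedges (tG_comp n Abar bbar (Vt k))))
                 \<le> int (card (tVp (Vt k))) - 1))"
proof -
  define G where "G = B_H_del n Abar bbar j"
  let ?B = "B_H n Abar bbar"
  let ?Dj = "del_verts (tG n Abar bbar) {Xin n, Xout j}"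
  let ?Di = "del_verts (tG n Abar bbar) {Xout j, Xin i}"
  let ?D = "tG_M n Abar bbar j M"
  let ?E = "{e \<in> bedges G. fst e \<noteq> i}"
  let ?L = "lambda_edges n" and ?S = "lambda_edges n \<inter> sys_edges n Abar bbar"
  note dm = assms(8)[folded G_def]
  have G: "bleft G = {..<n}" "bright G = {..<n + 1} - {j}"
    "bedges G = {e \<in> bedges ?B. snd e \<noteq> j}"
    by (simp_all add: G_def B_H_del_simps)
  have balanced: "balanced_bigraph G"
    using \<open>j < n + 1\<close> unfolding balanced_bigraph_def G by (auto simp: bedges_B_H)
  have arcs_D0: "arcs ?Dj = arc_of ` bedges G"
    unfolding arcs_del_verts_tG G by (intro arg_cong[of _ _ "image arc_of"]) (auto simp: bedges_B_H)
  have arcs_Di: "arcs ?Di = arc_of ` {e \<in> bedges G. fst e \<noteq> i}"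
    unfolding arcs_del_verts_tG G by (intro arg_cong[of _ _ "image arc_of"]) auto
  obtain M0 where M0: "M0 \<subseteq> bedges G" "family_edges M = arc_of ` M0" "inj_on fst M0" "inj_on snd M0"
    using path_families_iff_matchings[OF refl arcs_D0, of "family_edges M"] assms(11) by auto
  have "card M0 = n"
    using assms(12) M0(2) card_image[OF inj_arc_of, of M0] by (simp add: family_size_def)
  then have perfect: "perfect_matching G M0"
    using M0 by (simp add: perfect_iff_card[OF balanced] matching_def G(1))
  have blocks: "dm_blocks G d Vp Vm M0"
    using balanced perfect dm by (simp add: dm_blocks_def dm_decomposition_def)
  then interpret dm_blocks G d Vp Vm M0 .
  let ?W = "\<lambda>k. block_verts (Vp k) (Vm k)"
  have D: "verts ?D = block_verts (bleft G) (bright G)"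
    "arcs ?D = arc_of ` bedges G \<union> (arc_of ` M0)\<inverse>" "tail ?D = fst" "head ?D = snd"
    using arcs_D0 M0(2)
    by (auto simp: tG_M_def Let_def del_verts_tG_simps block_verts_def G less_Suc_eq)
  have ends: "arcs_ends ?D = arc_of ` bedges G \<union> (arc_of ` M0)\<inverse>"
    using D by (simp add: arcs_ends_def arc_to_ends_def)
  have "wf_digraph ?D"
  proof
    fix e assume "e \<in> arcs ?D"
    then have "e \<in> arc_of ` bedges G \<union> (arc_of ` bedges G)\<inverse>" using D(2) M0(1) by auto
    then show "tail ?D e \<in> verts ?D" "head ?D e \<in> verts ?D"
      using edges unfolding D(1,3,4) by (auto simp: arc_of_def)
  qed
  from sccs_verts_eq_blocks[OF blocks dm this D(1) ends]
  have sccs: "Vt ` {1..d'} = ?W ` {1..d}" using assms(13) by (simp add: bij_betw_def)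
  have induced: "bedges ?B \<inter> (R \<times> C) = bedges G \<inter> (R \<times> C)" if "C \<subseteq> bright G" for R C
    using that unfolding G by auto
  have Vm_sub: "Vm k \<subseteq> bright G" if "k \<in> {1..d}" for k
    unfolding right_eq[symmetric] using that by blast
  have comp: "bedges (tG_comp n Abar bbar (?W k)) = arc_of ` bedges (block k)" if "k \<in> {1..d}" for k
    using induced[OF Vm_sub[OF that]] by (simp add: bedges_tG_comp)
  have gamma: "gamma_nz (tE_I n) (tE_I n \<inter> tE_A n Abar) (tG_comp n Abar bbar (?W k))
      = gamma_nz ?L ?S (block k)" if "k \<in> {1..d}" for k
    unfolding self_loops_arc_of[of n Abar bbar]
    by (rule gamma_nz_arc_of) (simp_all only: comp[OF that] tE_I_arc_of arc_of_image_Int)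
  let ?light = "\<lambda>k N. gamma_nz ?L ?S (block k) = 1 \<and> card (N \<inter> bedges (block k)) < card (Vp k)"
  define light where "light N' \<longleftrightarrow> (\<exists>k \<in> tOmega n Abar bbar d' Vt.
      int (card (N' \<inter> bedges (tG_comp n Abar bbar (Vt k)))) \<le> int (card (tVp (Vt k))) - 1)" for N'
  have right: "light (arc_of ` N) \<longleftrightarrow> (\<exists>k \<in> {1..d}. ?light k N)" for N
  proof -
    let ?Q = "\<lambda>V. gamma_nz (tE_I n) (tE_I n \<inter> tE_A n Abar) (tG_comp n Abar bbar V) = 1 \<and>
      int (card (arc_of ` N \<inter> bedges (tG_comp n Abar bbar V))) \<le> int (card (tVp V)) - 1"
    have Q: "?Q (?W k) \<longleftrightarrow> ?light k N" if "k \<in> {1..d}" for k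
    proof -
      have "card (tVp (?W k)) = card (Vp k)"
        unfolding tVp_block_verts block_card[OF that] by (rule card_image) (simp add: inj_on_def)
      moreover have "card (arc_of ` N \<inter> bedges (tG_comp n Abar bbar (?W k))) = card (N \<inter> bedges (block k))"
        unfolding comp[OF that] arc_of_image_Int by (rule card_image[OF inj_arc_of])
      ultimately show ?thesis unfolding gamma[OF that] by auto
    qed
    have "light (arc_of ` N) \<longleftrightarrow> (\<exists>V \<in> Vt ` {1..d'}. ?Q V)"
      by (auto simp: light_def tOmega_def)
    also have "\<dots> \<longleftrightarrow> (\<exists>k \<in> {1..d}. ?Q (?W k))" unfolding sccs by blast
    also have "\<dots> \<longleftrightarrow> (\<exists>k \<in> {1..d}. ?light k N)" using Q by (intro bex_cong) auto
    finally show ?thesis .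
  qed
  \<comment> \<open>\<open>n - 1\<close> matched rows other than \<open>i\<close> are all the rows other than \<open>i\<close>\<close>
  have deficient: "N \<subseteq> {e \<in> bedges G. fst e \<noteq> i} \<and> inj_on fst N \<and> inj_on snd N \<and> card N = n - 1
      \<longleftrightarrow> matching G N \<and> fst ` N = bleft G - {i}" for N
  proof
    assume N: "N \<subseteq> {e \<in> bedges G. fst e \<noteq> i} \<and> inj_on fst N \<and> inj_on snd N \<and> card N = n - 1"
    then have "fst ` N \<subseteq> bleft G - {i}" using edges by auto
    moreover have "card (fst ` N) = card (bleft G - {i})"
      using N \<open>i < n\<close> by (simp add: card_image G)
    ultimately show "matching G N \<and> fst ` N = bleft G - {i}"
      using N finite_left card_subset_eq[of "bleft G - {i}" "fst ` N"] by (auto simp: matching_def)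
  next
    assume N: "matching G N \<and> fst ` N = bleft G - {i}"
    then have "card N = card (bleft G - {i})" using matching_card_fst[of G N] by simp
    moreover have "fst e \<noteq> i" if "e \<in> N" for e using N that by (metis DiffD2 image_eqI singletonI)
    ultimately show "N \<subseteq> {e \<in> bedges G. fst e \<noteq> i} \<and> inj_on fst N \<and> inj_on snd N \<and> card N = n - 1"
      using N \<open>i < n\<close> by (auto simp: matching_def G)
  qed
  have card_arc_of: "card (arc_of ` N) = card N" for N by (rule card_image[OF inj_arc_of])
  have "(\<exists>k \<in> Omega n Abar bbar j Vp Vm istar.
            minWMM (G_ki n Abar bbar Vp Vm i istar k) (weight_k n Abar bbar j Vp Vm k) < card (Vp k))
    \<longleftrightarrow> (\<exists>k \<in> {1..d}. gamma_nz ?L ?S (block k) = 1 \<and> (k \<le> istar \<and>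
          minWMM (G_ki n Abar bbar Vp Vm i istar k) (weight_k n Abar bbar j Vp Vm k) < card (Vp k)))"
    using \<open>istar \<in> {1..d}\<close> by (auto simp: Omega_def dm_comp_def G_def[symmetric] simp del: bi_induce_simps)
  also have "\<dots> \<longleftrightarrow> (\<exists>k \<in> {1..d}. gamma_nz ?L ?S (block k) = 1 \<and>
      (\<exists>N. matching G N \<and> fst ` N = bleft G - {i} \<and> card (N \<inter> bedges (block k)) < card (Vp k)))"
  proof (intro bex_cong refl conj_cong)
    fix k assume k: "k \<in> {1..d}"
    have "(\<Union>l \<in> {k..istar}. Vm l) \<subseteq> bright G"
      unfolding right_eq[symmetric] using k \<open>istar \<in> {1..d}\<close> by force
    then have "G_ki n Abar bbar Vp Vm i istar k =
        bi_induce G ((\<Union>l \<in> {k..istar}. Vp l) - {i}) (\<Union>l \<in> {k..istar}. Vm l)"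
      using induced by (simp add: G_ki_def bi_induce_def)
    moreover have "weight_k n Abar bbar j Vp Vm k = (\<lambda>e. if e \<in> bedges (block k) then 1 else 0)"
      by (simp add: weight_k_def dm_comp_def G_def fun_eq_iff)
    ultimately show "(k \<le> istar \<and>
          minWMM (G_ki n Abar bbar Vp Vm i istar k) (weight_k n Abar bbar j Vp Vm k) < card (Vp k))
      \<longleftrightarrow> (\<exists>N. matching G N \<and> fst ` N = bleft G - {i} \<and> card (N \<inter> bedges (block k)) < card (Vp k))"
      using light_window_matching_iff[OF k assms(9,10)] by (simp only:)
  qed
  also have "\<dots> \<longleftrightarrow> (\<exists>N. (matching G N \<and> fst ` N = bleft G - {i}) \<and> (\<exists>k \<in> {1..d}. ?light k N))"
    by blast
  also have "\<dots> \<longleftrightarrow> (\<exists>N. (N \<subseteq> ?E \<and> inj_on fst N \<and> inj_on snd N \<and> card N = n - 1) \<and> light (arc_of ` N))"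
    unfolding deficient right ..
  also have "\<dots> \<longleftrightarrow> (\<exists>N'. (\<exists>N \<subseteq> ?E. N' = arc_of ` N \<and> inj_on fst N \<and> inj_on snd N)
      \<and> card N' = n - 1 \<and> light N')"
    (is "?left \<longleftrightarrow> ?right")
  proof
    assume ?left
    then obtain N where "N \<subseteq> ?E" "inj_on fst N" "inj_on snd N" "card N = n - 1" "light (arc_of ` N)"
      by blast
    then show ?right by (intro exI[of _ "arc_of ` N"] conjI exI[of _ N]) (simp_all only: card_arc_of)
  next
    assume ?right
    then obtain N where "N \<subseteq> ?E" "inj_on fst N" "inj_on snd N"
      "card (arc_of ` N) = n - 1" "light (arc_of ` N)"
      by blast
    then show ?left by (intro exI[of _ N] conjI) (simp_all only: card_arc_of)
  qed
  also have "\<dots> \<longleftrightarrow> (\<exists>N'. (\<exists>P. path_family ?Di P \<and> family_edges P = N') \<and> card N' = n - 1 \<and> light N')"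
    unfolding path_families_iff_matchings[OF refl arcs_Di] ..
  also have "\<dots> \<longleftrightarrow> (\<exists>Mt. path_family ?Di Mt \<and> family_size Mt = n - 1 \<and> light (family_edges Mt))"
    unfolding family_size_def by blast
  finally show ?thesis unfolding light_def .
qed

end
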